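(* (Sylvester criterion) A hyperhermitian $n\times n$ quaternionic matrix $A$ is positive definite if and only if $\det M_{\{i+1,\dots,n\}}(A)>0$ for every $0\le i\le n$.
   Context: $\mathbb{H}$ is the skew field of quaternions. A quaternionic square matrix $A=(a_{ij})$ is hyperhermitian if $a_{ij}=\overline{a_{ji}}$ for all $i,j$. It is positive definite if $\sum_{i,j}\bar x_i a_{ij}x_j>0$ for every non-zero $x\in\mathbb{H}^n$. Moore determinant: for a hyperhermitian $n\times n$ matrix $A$ let ${}^{\mathbb R}A$ be the real $4n\times 4n$ matrix of the symmetric bilinear form $(x,y)\mapsto \mathrm{Re}\sum_{i,j}\bar x_i a_{ij}y_j$ on $\mathbb{H}^n\cong\mathbb{R}^{4n}$. There is a unique polynomial $P$ on the real vector space of hyperhermitian $n\times n$ matrices with $\det({}^{\mathbb R}A)=P(A)^4$ for all $A$ and $P(\mathrm{Id})=1$; the Moore determinant is $\det A:=P(A)\in\mathbb{R}$. (If $A=C^*\mathrm{diag}(\lambda_1,\dots,\lambda_n)C$ with $\lambda_i\in\mathbb{R}$ and $C^*C=\mathrm{Id}$, then $\det A=\prod_i\lambda_i$.) For $I\subset\{1,\dots,n\}$, $M_I(A)$ is the (hyperhermitian) matrix obtained from $A$ by deleting the rows and columns with indices in $I$; $M_\emptyset(A)=A$, and by convention $\det M_{\{1,\dots,n\}}(A)=1$. *)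

theory Defs
  imports
    Complex_Main
    "HOL-Library.FuncSet"
    "Jordan_Normal_Form.Determinant"
    "Jordan_Normal_Form.DL_Submatrix"
begin

section \<open>The skew field of quaternions\<close>

datatype quat = Quat (qre: real) (qi: real) (qj: real) (qk: real)

lemma quat_eq_iff:
  "x = y \<longleftrightarrow> qre x = qre y \<and> qi x = qi y \<and> qj x = qj y \<and> qk x = qk y"
  by (cases x; cases y) simp

definition qcnj :: "quat \<Rightarrow> quat" where
  "qcnj x = Quat (qre x) (- qi x) (- qj x) (- qk x)"

definition qnorm_sq :: "quat \<Rightarrow> real" where
  "qnorm_sq x = (qre x)\<^sup>2 + (qi x)\<^sup>2 + (qj x)\<^sup>2 + (qk x)\<^sup>2"

instantiation quat :: ab_group_add
begin

definition "0 = Quat 0 0 0 0"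
definition "x + y = Quat (qre x + qre y) (qi x + qi y) (qj x + qj y) (qk x + qk y)"
definition "- x = Quat (- qre x) (- qi x) (- qj x) (- qk x)"
definition "x - y = Quat (qre x - qre y) (qi x - qi y) (qj x - qj y) (qk x - qk y)"

instance
  by standard
    (simp_all add: quat_eq_iff zero_quat_def plus_quat_def uminus_quat_def minus_quat_def)

end

instantiation quat :: real_algebra_1
begin

definition "1 = Quat 1 0 0 0"
definition "x * y = Quat
  (qre x * qre y - qi x * qi y - qj x * qj y - qk x * qk y)
  (qre x * qi y + qi x * qre y + qj x * qk y - qk x * qj y)
  (qre x * qj y - qi x * qk y + qj x * qre y + qk x * qi y)
  (qre x * qk y + qi x * qj y - qj x * qi y + qk x * qre y)"
definition "r *\<^sub>R x = Quat (r * qre x) (r * qi x) (r * qj x) (r * qk x)"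

instance
  by standard
    (simp_all add: quat_eq_iff zero_quat_def plus_quat_def one_quat_def times_quat_def
      scaleR_quat_def algebra_simps)

end

instantiation quat :: real_div_algebra
begin

definition "inverse x = (1 / qnorm_sq x) *\<^sub>R qcnj x"
definition "x div y = x * inverse y" for x y :: quat

lemma qnorm_sq_eq_0_iff: "qnorm_sq x = 0 \<longleftrightarrow> x = 0"
  by (simp add: qnorm_sq_def quat_eq_iff zero_quat_def add_nonneg_eq_0_iff)

lemma qcnj_mult_self: "qcnj x * x = qnorm_sq x *\<^sub>R 1" "x * qcnj x = qnorm_sq x *\<^sub>R 1"
  by (simp_all add: quat_eq_iff qcnj_def qnorm_sq_def times_quat_def one_quat_def
      scaleR_quat_def power2_eq_square)

instance
proof
  fix x :: quat
  show "x \<noteq> 0 \<Longrightarrow> inverse x * x = 1" "x \<noteq> 0 \<Longrightarrow> x * inverse x = 1"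
    by (simp_all add: inverse_quat_def qcnj_mult_self qnorm_sq_eq_0_iff)
  show "inverse (0 :: quat) = 0"
    by (simp add: inverse_quat_def qnorm_sq_def zero_quat_def scaleR_quat_def)
qed (simp add: divide_quat_def)

end


section \<open>Hyperhermitian matrices\<close>

definition hyperhermitian :: "nat \<Rightarrow> quat mat set" where
  "hyperhermitian n =
     {A \<in> carrier_mat n n. \<forall>i<n. \<forall>j<n. A $$ (i, j) = qcnj (A $$ (j, i))}"

definition hform :: "quat mat \<Rightarrow> quat vec \<Rightarrow> quat vec \<Rightarrow> quat" where
  "hform A x y = (\<Sum>i<dim_row A. \<Sum>j<dim_col A. qcnj (x $ i) * A $$ (i, j) * y $ j)"

text \<open>The inequality \<open>hform A x x > 0\<close> asserts in particular that the quaternion is real.\<close>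

definition positive_definite :: "quat mat \<Rightarrow> bool" where
  "positive_definite A \<longleftrightarrow>
     (\<forall>x \<in> carrier_vec (dim_row A). x \<noteq> 0\<^sub>v (dim_row A) \<longrightarrow>
        (\<exists>r::real. r > 0 \<and> hform A x x = of_real r))"


section \<open>The Moore determinant\<close>

text \<open>The real basis of the \<open>n\<close>-dimensional quaternionic space: position \<open>4 * i + p\<close> carries
  the vector whose \<open>i\<close>-th coordinate is the \<open>p\<close>-th of the units \<open>1, i, j, k\<close>.\<close>

definition quat_unit :: "nat \<Rightarrow> quat" where
  "quat_unit p = [Quat 1 0 0 0, Quat 0 1 0 0, Quat 0 0 1 0, Quat 0 0 0 1] ! p"

definition real_basis :: "nat \<Rightarrow> nat \<Rightarrow> quat vec" where
  "real_basis n r = vec n (\<lambda>i. if i = r div 4 then quat_unit (r mod 4) else 0)"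

definition realification :: "quat mat \<Rightarrow> real mat" where
  "realification A = (let n = dim_row A in
     mat (4 * n) (4 * n) (\<lambda>(r, s). qre (hform A (real_basis n r) (real_basis n s))))"

text \<open>Polynomial functions in the real components of the entries. These components span the dual
  of the real vector space of hyperhermitian matrices, so the restrictions of such functions to
  this space are exactly the polynomials on it.\<close>

inductive entry_polynomial :: "nat \<Rightarrow> (quat mat \<Rightarrow> real) \<Rightarrow> bool" for n where
  const: "entry_polynomial n (\<lambda>A. c)"
| re: "i < n \<Longrightarrow> j < n \<Longrightarrow> entry_polynomial n (\<lambda>A. qre (A $$ (i, j)))"
| im_i: "i < n \<Longrightarrow> j < n \<Longrightarrow> entry_polynomial n (\<lambda>A. qi (A $$ (i, j)))"
| im_j: "i < n \<Longrightarrow> j < n \<Longrightarrow> entry_polynomial n (\<lambda>A. qj (A $$ (i, j)))"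
| im_k: "i < n \<Longrightarrow> j < n \<Longrightarrow> entry_polynomial n (\<lambda>A. qk (A $$ (i, j)))"
| add: "entry_polynomial n f \<Longrightarrow> entry_polynomial n g \<Longrightarrow> entry_polynomial n (\<lambda>A. f A + g A)"
| mult: "entry_polynomial n f \<Longrightarrow> entry_polynomial n g \<Longrightarrow> entry_polynomial n (\<lambda>A. f A * g A)"

text \<open>Restricting to the space makes two polynomials equal as soon as they agree on it, which
  uniqueness of the Moore polynomial needs.\<close>

definition hyperhermitian_polynomials :: "nat \<Rightarrow> (quat mat \<Rightarrow> real) set" where
  "hyperhermitian_polynomials n = (\<lambda>f. restrict f (hyperhermitian n)) ` Collect (entry_polynomial n)"

definition is_moore_polynomial :: "nat \<Rightarrow> (quat mat \<Rightarrow> real) \<Rightarrow> bool" where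
  "is_moore_polynomial n P \<longleftrightarrow>
     P \<in> hyperhermitian_polynomials n \<and>
     (\<forall>A \<in> hyperhermitian n. det (realification A) = P A ^ 4) \<and>
     P (1\<^sub>m n) = 1"

definition moore_det :: "quat mat \<Rightarrow> real" where
  "moore_det A = (THE P. is_moore_polynomial (dim_row A) P) A"

text \<open>For the matrix of size 0 the definition yields the usual convention.\<close>

lemma moore_det_dim_0:
  assumes "A \<in> carrier_mat 0 0"
  shows "moore_det A = 1"
proof -
  have H: "hyperhermitian 0 = {1\<^sub>m 0}"
    by (auto simp: hyperhermitian_def)
  have det: "det (realification (1\<^sub>m 0)) = 1"
    by (rule det_dim_zero) (simp add: realification_def)
  define P where "P = restrict (\<lambda>A. 1 :: real) (hyperhermitian 0)"
  have P: "is_moore_polynomial 0 P"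
    unfolding is_moore_polynomial_def hyperhermitian_polynomials_def
    by (auto simp: P_def H det intro!: imageI entry_polynomial.const)
  have "Q = P" if "is_moore_polynomial 0 Q" for Q
    using that unfolding is_moore_polynomial_def hyperhermitian_polynomials_def
    by (auto simp: P_def H restrict_def fun_eq_iff)
  with P have "(THE P. is_moore_polynomial 0 P) = P"
    by (intro the_equality)
  moreover have "A = 1\<^sub>m 0"
    using assms by auto
  ultimately show ?thesis
    by (simp add: moore_det_def P_def H)
qed


section \<open>Principal minors\<close>

text \<open>Rows and columns are numbered from \<open>0\<close>.\<close>

definition delete_indices :: "nat set \<Rightarrow> 'a mat \<Rightarrow> 'a mat" where
  "delete_indices I A = submatrix A (- I) (- I)"

end

theory Submission
  imports Defs "Jordan_Normal_Form.Char_Poly"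
begin

text \<open>
  Everything rests on the quaternionic spectral theorem: a hyperhermitian \<open>A\<close> factors as
  \<open>U D U\<^sup>*\<close> with \<open>U\<close> unitary and \<open>D\<close> real diagonal (\<open>quaternionic_spectral_theorem\<close>).
  A real eigenvalue exists because the realification of \<open>A\<close> is a symmetric real matrix, whose
  eigenvectors translate back into quaternionic ones; a Householder reflection then splits off one
  coordinate.

  Realification is multiplicative and turns \<open>D = diag(l\<^sub>0, l\<^sub>1, \<dots>)\<close> into a diagonal matrix with every
  \<open>l\<^sub>i\<close> repeated four times. Hence the characteristic polynomial of the realification is the fourth
  power of \<open>\<Prod>(X - l\<^sub>i)\<close>, and its determinant is \<open>(\<Prod>l\<^sub>i)\<^sup>4\<close>. The candidate for the Moore polynomial is
  therefore \<open>\<Prod>l\<^sub>i\<close>, and what has to be shown is that it depends polynomially on the entries of \<open>A\<close>.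
  The coefficients of the characteristic polynomial are polynomials in the entries, and those of a square root with constant coefficient 1 follow from them
  by a recursion that only divides by 2 (\<open>herm_polynomial_coeffs_sqrt\<close>). Two square roots of the
  reversed characteristic polynomial give \<open>\<Prod>(1 - l\<^sub>i X)\<close>, whose coefficient at \<open>X\<^sup>n\<close> is \<open>\<Prod>l\<^sub>i\<close> up to
  sign. Uniqueness is seen on the line through the identity and a given matrix, where two Moore
  polynomials become real polynomials that agree up to sign and have the value 1 at the identity.
  So the Moore determinant is the product of the eigenvalues.

  The criterion follows by comparing the eigenvalues with the leading minors. If \<open>A\<close> is positive
  definite, so are its leading submatrices, and a product of positive eigenvalues is positive.
  Conversely, let the leading submatrix of size \<open>m\<close> be positive definite and the determinant of the one
  of size \<open>m + 1\<close> be positive. If the latter had an eigenvalue that is not positive, it would have two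
  negative ones, as the product is positive; in the span of two corresponding
  orthogonal eigenvectors lies a non-zero vector with vanishing last coordinate. The form is negative
  there, yet on such vectors it is the form of the smaller, positive definite submatrix
  (\<open>positive_definite_step\<close>).
\<close>

section \<open>Quaternions and quaternionic matrices\<close>

lemma quat_sel_simps [simp]:
  "qre (0::quat) = 0" "qi (0::quat) = 0" "qj (0::quat) = 0" "qk (0::quat) = 0"
  "qre (1::quat) = 1" "qi (1::quat) = 0" "qj (1::quat) = 0" "qk (1::quat) = 0"
  "qre (x + y) = qre x + qre y" "qi (x + y) = qi x + qi y"
  "qj (x + y) = qj x + qj y" "qk (x + y) = qk x + qk y"
  "qre (x - y) = qre x - qre y" "qi (x - y) = qi x - qi y"
  "qj (x - y) = qj x - qj y" "qk (x - y) = qk x - qk y"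
  "qre (- x) = - qre x" "qi (- x) = - qi x" "qj (- x) = - qj x" "qk (- x) = - qk x"
  "qre (r *\<^sub>R x) = r * qre x" "qi (r *\<^sub>R x) = r * qi x"
  "qj (r *\<^sub>R x) = r * qj x" "qk (r *\<^sub>R x) = r * qk x"
  "qre (of_real r) = r" "qi (of_real r) = 0" "qj (of_real r) = 0" "qk (of_real r) = 0"
  "qre (qcnj x) = qre x" "qi (qcnj x) = - qi x" "qj (qcnj x) = - qj x" "qk (qcnj x) = - qk x"
  by (simp_all add: zero_quat_def one_quat_def plus_quat_def minus_quat_def uminus_quat_def
      scaleR_quat_def of_real_def qcnj_def)

lemma quat_sel_times:
  "qre (x * y) = qre x * qre y - qi x * qi y - qj x * qj y - qk x * qk y"
  "qi (x * y) = qre x * qi y + qi x * qre y + qj x * qk y - qk x * qj y"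
  "qj (x * y) = qre x * qj y - qi x * qk y + qj x * qre y + qk x * qi y"
  "qk (x * y) = qre x * qk y + qi x * qj y - qj x * qi y + qk x * qre y"
  by (simp_all add: times_quat_def)

lemma quat_sel_sum:
  "qre (sum f S) = (\<Sum>x\<in>S. qre (f x))" "qi (sum f S) = (\<Sum>x\<in>S. qi (f x))"
  "qj (sum f S) = (\<Sum>x\<in>S. qj (f x))" "qk (sum f S) = (\<Sum>x\<in>S. qk (f x))"
  by (induction S rule: infinite_finite_induct; simp)+

lemma qcnj_qcnj [simp]: "qcnj (qcnj x) = x"
  and qcnj_0 [simp]: "qcnj 0 = 0"
  and qcnj_1 [simp]: "qcnj 1 = 1"
  and qcnj_of_real [simp]: "qcnj (of_real r) = of_real r"
  and qcnj_add [simp]: "qcnj (x + y) = qcnj x + qcnj y"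
  and qcnj_mult [simp]: "qcnj (x * y) = qcnj y * qcnj x"
  by (simp_all add: quat_eq_iff quat_sel_times algebra_simps)

lemma qcnj_sum: "qcnj (sum f S) = (\<Sum>x\<in>S. qcnj (f x))"
  by (induction S rule: infinite_finite_induct) simp_all

lemma mult_of_real_quat_left_commute: "x * (of_real r * y) = of_real r * (x * y :: quat)"
  by (simp add: quat_eq_iff quat_sel_times algebra_simps)

lemma qcnj_mult_self': "qcnj x * x = of_real (qnorm_sq x)" "x * qcnj x = of_real (qnorm_sq x)"
  by (simp_all add: qcnj_mult_self of_real_def)

lemma qnorm_sq_nonneg [simp]: "qnorm_sq x \<ge> 0"
  by (simp add: qnorm_sq_def)

lemma qnorm_sq_pos_iff: "qnorm_sq x > 0 \<longleftrightarrow> x \<noteq> 0"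
  using qnorm_sq_eq_0_iff[of x] qnorm_sq_nonneg[of x] by linarith

lemma qnorm_sq_mult: "qnorm_sq (x * y) = qnorm_sq x * qnorm_sq y"
  by (simp add: qnorm_sq_def quat_sel_times power2_eq_square algebra_simps)

lemma qnorm_sq_of_real [simp]: "qnorm_sq (of_real r) = r\<^sup>2"
  by (simp add: qnorm_sq_def)

definition qadj :: "quat mat \<Rightarrow> quat mat" where
  "qadj A = mat (dim_col A) (dim_row A) (\<lambda>(i, j). qcnj (A $$ (j, i)))"

definition real_diag :: "nat \<Rightarrow> (nat \<Rightarrow> real) \<Rightarrow> quat mat" where
  "real_diag n l = mat n n (\<lambda>(i, j). if i = j then of_real (l i) else 0)"

definition qunitary :: "nat \<Rightarrow> quat mat \<Rightarrow> bool" where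
  "qunitary n U \<longleftrightarrow> U \<in> carrier_mat n n \<and> qadj U * U = 1\<^sub>m n \<and> U * qadj U = 1\<^sub>m n"

definition qinner :: "quat vec \<Rightarrow> quat vec \<Rightarrow> quat" where
  "qinner x y = (\<Sum>i<dim_vec x. qcnj (x $ i) * y $ i)"

lemma qadj_carrier [simp]: "A \<in> carrier_mat n m \<Longrightarrow> qadj A \<in> carrier_mat m n"
  by (simp add: qadj_def)

lemma real_diag_carrier [simp]: "real_diag n l \<in> carrier_mat n n"
  by (simp add: real_diag_def)

lemma dim_qadj [simp]: "dim_row (qadj A) = dim_col A" "dim_col (qadj A) = dim_row A"
  by (simp_all add: qadj_def)

lemma index_qadj [simp]: "i < dim_col A \<Longrightarrow> j < dim_row A \<Longrightarrow> qadj A $$ (i, j) = qcnj (A $$ (j, i))"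
  by (simp add: qadj_def)

lemma index_real_diag:
  "i < n \<Longrightarrow> j < n \<Longrightarrow> real_diag n l $$ (i, j) = (if i = j then of_real (l i) else 0)"
  by (simp add: real_diag_def)

lemma qadj_qadj [simp]: "qadj (qadj A) = A"
  by (rule eq_matI) auto

lemma qadj_real_diag [simp]: "qadj (real_diag n l) = real_diag n l"
  by (rule eq_matI) (auto simp: real_diag_def)

lemma index_mult_mat_sum:
  assumes "A \<in> carrier_mat n m" "B \<in> carrier_mat m k" "i < n" "j < k"
  shows "(A * B) $$ (i, j) = (\<Sum>t<m. A $$ (i, t) * B $$ (t, j))"
  using assms by (simp add: scalar_prod_def lessThan_atLeast0)

lemma index_mult_mat_vec_sum:
  assumes "A \<in> carrier_mat n m" "x \<in> carrier_vec m" "i < n"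
  shows "(A *\<^sub>v x) $ i = (\<Sum>t<m. A $$ (i, t) * x $ t)"
  using assms by (simp add: scalar_prod_def lessThan_atLeast0)

lemma qadj_mult:
  assumes "A \<in> carrier_mat n m" "B \<in> carrier_mat m k"
  shows "qadj (A * B) = qadj B * qadj A"
proof (rule eq_matI)
  fix i j assume "i < dim_row (qadj B * qadj A)" "j < dim_col (qadj B * qadj A)"
  then have ij: "i < k" "j < n" using assms by auto
  then have "qadj (A * B) $$ (i, j) = qcnj ((A * B) $$ (j, i))"
    using assms by simp
  also have "\<dots> = (\<Sum>t<m. qcnj (B $$ (t, i)) * qcnj (A $$ (j, t)))"
    using ij assms by (subst index_mult_mat_sum[of A n m B k]) (simp_all add: qcnj_sum)
  also have "\<dots> = (qadj B * qadj A) $$ (i, j)"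
    using ij assms by (subst index_mult_mat_sum[of "qadj B" k m "qadj A" n]) simp_all
  finally show "qadj (A * B) $$ (i, j) = (qadj B * qadj A) $$ (i, j)" .
qed (use assms in auto)

lemma hyperhermitian_carrier: "A \<in> hyperhermitian n \<Longrightarrow> A \<in> carrier_mat n n"
  by (simp add: hyperhermitian_def)

lemma hyperhermitian_iff_self_adjoint:
  "A \<in> hyperhermitian n \<longleftrightarrow> A \<in> carrier_mat n n \<and> qadj A = A"
proof
  assume A: "A \<in> hyperhermitian n"
  then have c: "A \<in> carrier_mat n n" by (simp add: hyperhermitian_def)
  have "qadj A $$ (i, j) = A $$ (i, j)" if "i < n" "j < n" for i j
  proof -
    have "A $$ (i, j) = qcnj (A $$ (j, i))"
      using A that unfolding hyperhermitian_def by blast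
    then show ?thesis using c that by simp
  qed
  with c show "A \<in> carrier_mat n n \<and> qadj A = A"
    by (intro conjI eq_matI) simp_all
next
  assume A: "A \<in> carrier_mat n n \<and> qadj A = A"
  then have "A $$ (i, j) = qcnj (A $$ (j, i))" if "i < n" "j < n" for i j
    using index_qadj[of i A j] that by (metis carrier_matD)
  with A show "A \<in> hyperhermitian n"
    unfolding hyperhermitian_def by blast
qed

lemma hform_eq_qinner:
  assumes "A \<in> carrier_mat n m" "x \<in> carrier_vec n" "y \<in> carrier_vec m"
  shows "hform A x y = qinner x (A *\<^sub>v y)"
  using assms
  by (simp add: hform_def qinner_def index_mult_mat_vec_sum[OF assms(1,3)] sum_distrib_left mult.assoc
      del: index_mult_mat_vec)

lemma qinner_mult_mat_vec:
  assumes "A \<in> carrier_mat n m" "x \<in> carrier_vec n" "y \<in> carrier_vec m"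
  shows "qinner x (A *\<^sub>v y) = qinner (qadj A *\<^sub>v x) y"
proof -
  have "qinner x (A *\<^sub>v y) = (\<Sum>i<n. \<Sum>j<m. qcnj (x $ i) * A $$ (i, j) * y $ j)"
    using assms by (simp add: qinner_def index_mult_mat_vec_sum[OF assms(1,3)] sum_distrib_left mult.assoc
      del: index_mult_mat_vec)
  also have "\<dots> = (\<Sum>j<m. \<Sum>i<n. qcnj (x $ i) * A $$ (i, j) * y $ j)"
    by (rule sum.swap)
  also have "\<dots> = qinner (qadj A *\<^sub>v x) y"
    using assms by (simp add: qinner_def index_mult_mat_vec_sum[of "qadj A" m n] sum_distrib_right
        qcnj_sum del: index_mult_mat_vec)
  finally show ?thesis .
qed

section \<open>The realification\<close>

text \<open>The realification indexes its rows by \<open>4 * i + p\<close>; sums and products over such indices regroup into blocks of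
  four.\<close>

lemma sum_lessThan_4_mult: "(\<Sum>r<4 * n. f r) = (\<Sum>i<n. \<Sum>p<4. f (4 * i + p))"
  for f :: "nat \<Rightarrow> 'a :: comm_monoid_add"
proof (induction n)
  case (Suc n)
  have "(\<Sum>r<4 * Suc n. f r) = (\<Sum>r<4 * n. f r) + (\<Sum>p<4. f (4 * n + p))"
    by (simp add: eval_nat_numeral add.assoc)
  then show ?case by (simp add: Suc)
qed simp

lemma all_less_4: "(\<forall>p<4. P p) \<longleftrightarrow> P 0 \<and> P 1 \<and> P 2 \<and> P (3::nat)"
  by (auto simp: less_Suc_eq eval_nat_numeral)

lemma quat_unit_simps [simp]:
  "quat_unit 0 = Quat 1 0 0 0" "quat_unit 1 = Quat 0 1 0 0" "quat_unit (Suc 0) = Quat 0 1 0 0"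
  "quat_unit 2 = Quat 0 0 1 0" "quat_unit 3 = Quat 0 0 0 1"
  by (simp_all add: quat_unit_def)

lemma realification_carrier [simp]:
  "A \<in> carrier_mat n n \<Longrightarrow> realification A \<in> carrier_mat (4 * n) (4 * n)"
  by (simp add: realification_def Let_def)

lemma index_realification:
  assumes "A \<in> carrier_mat n n" "r < 4 * n" "s < 4 * n"
  shows "realification A $$ (r, s) =
    qre (qcnj (quat_unit (r mod 4)) * A $$ (r div 4, s div 4) * quat_unit (s mod 4))"
proof -
  have rs: "r div 4 < n" "s div 4 < n" using assms by auto
  have "hform A (real_basis n r) (real_basis n s) =
    (\<Sum>i<n. \<Sum>j<n. qcnj (real_basis n r $ i) * A $$ (i, j) * real_basis n s $ j)"
    using assms by (simp add: hform_def)
  also have "\<dots> = (\<Sum>i<n. \<Sum>j<n. if j = s div 4 then (if i = r div 4 then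
      qcnj (quat_unit (r mod 4)) * A $$ (r div 4, s div 4) * quat_unit (s mod 4) else 0) else 0)"
    by (rule sum.cong[OF refl], rule sum.cong[OF refl]) (simp add: real_basis_def)
  also have "\<dots> = qcnj (quat_unit (r mod 4)) * A $$ (r div 4, s div 4) * quat_unit (s mod 4)"
    using rs by simp
  finally show ?thesis
    using assms by (simp add: realification_def Let_def)
qed

lemma sum_lessThan_4: "(\<Sum>p<4. f p) = f 0 + f 1 + f 2 + f (3::nat)"
  for f :: "nat \<Rightarrow> 'a :: comm_monoid_add"
  by (simp add: eval_nat_numeral)

text \<open>The units form an orthonormal basis for the real inner product \<open>Re (x\<^sup>* y)\<close>; inserting their resolution of
  the identity between \<open>x\<close> and \<open>y\<close> is what makes the realification multiplicative.\<close>

lemma qre_times_eq_sum_units: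
  "qre (x * y) = (\<Sum>p<4. qre (x * quat_unit p) * qre (qcnj (quat_unit p) * y))"
  unfolding sum_lessThan_4 by (simp add: quat_sel_times)

lemma realification_mult:
  assumes "A \<in> carrier_mat n n" "B \<in> carrier_mat n n"
  shows "realification (A * B) = realification A * realification B"
proof (rule eq_matI)
  fix r s assume "r < dim_row (realification A * realification B)"
    "s < dim_col (realification A * realification B)"
  then have rs: "r < 4 * n" "s < 4 * n"
    using assms realification_carrier by (metis index_mult_mat(2,3) carrier_matD)+
  then have rs': "r div 4 < n" "s div 4 < n" by auto
  let ?u = "qcnj (quat_unit (r mod 4))" and ?v = "quat_unit (s mod 4)"
  have "realification (A * B) $$ (r, s) = qre (?u * (A * B) $$ (r div 4, s div 4) * ?v)"
    using assms rs by (intro index_realification) auto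
  also have "\<dots> = (\<Sum>k<n. qre ((?u * A $$ (r div 4, k)) * (B $$ (k, s div 4) * ?v)))"
    unfolding index_mult_mat_sum[OF assms rs']
    by (simp add: sum_distrib_left sum_distrib_right quat_sel_sum mult.assoc)
  also have "\<dots> = (\<Sum>k<n. \<Sum>p<4. realification A $$ (r, 4 * k + p) * realification B $$ (4 * k + p, s))"
    by (subst qre_times_eq_sum_units)
       (auto simp: index_realification[OF assms(1)] index_realification[OF assms(2)] rs mult.assoc
             intro!: sum.cong)
  also have "\<dots> = (\<Sum>t<4 * n. realification A $$ (r, t) * realification B $$ (t, s))"
    by (rule sum_lessThan_4_mult[symmetric])
  also have "\<dots> = (realification A * realification B) $$ (r, s)"
    using assms rs by (intro index_mult_mat_sum[symmetric, where m = "4 * n"]) auto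
  finally show "realification (A * B) $$ (r, s) = (realification A * realification B) $$ (r, s)" .
qed (use assms in \<open>simp_all add: realification_def Let_def\<close>)

lemma index_realification_real_diag:
  assumes "r < 4 * n" "s < 4 * n"
  shows "realification (real_diag n l) $$ (r, s) = (if r = s then l (r div 4) else 0)"
proof (cases "r div 4 = s div 4")
  case True
  have "\<forall>p<4. \<forall>q<4. qre (qcnj (quat_unit p) * of_real c * quat_unit q) = (if p = q then c else 0)" for c
    unfolding all_less_4 by (simp add: quat_sel_times)
  moreover have "r = s \<longleftrightarrow> r mod 4 = s mod 4"
    using True by (metis mult_div_mod_eq)
  ultimately show ?thesis
    using assms True by (simp add: index_realification[OF real_diag_carrier] index_real_diag)
next
  case False
  then have "r \<noteq> s" by auto
  with False show ?thesis
    using assms by (simp add: index_realification[OF real_diag_carrier] index_real_diag)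
qed

lemma real_diag_1: "real_diag n (\<lambda>_. 1) = 1\<^sub>m n"
  by (rule eq_matI) (auto simp: real_diag_def)

lemma realification_1: "realification (1\<^sub>m n) = 1\<^sub>m (4 * n)"
proof (rule eq_matI)
  fix r s assume "r < dim_row (1\<^sub>m (4 * n) :: real mat)" "s < dim_col (1\<^sub>m (4 * n) :: real mat)"
  then show "realification (1\<^sub>m n) $$ (r, s) = 1\<^sub>m (4 * n) $$ (r, s)"
    using index_realification_real_diag[of r n s "\<lambda>_. 1"] by (simp add: real_diag_1)
qed (simp_all add: realification_def Let_def)

lemma prod_lessThan_4_mult: "(\<Prod>r<4 * n. f (r div 4)) = (\<Prod>i<n. f i) ^ 4"
  for f :: "nat \<Rightarrow> 'a :: comm_semiring_1"
proof -
  have "(\<Prod>r<n * 4. f (r div 4)) = (\<Prod>i<n. \<Prod>r=i * 4..<i * 4 + 4. f (r div 4))"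
    by (rule prod.nat_group[symmetric])
  also have "\<dots> = (\<Prod>i<n. \<Prod>r=i * 4..<i * 4 + 4. f i)"
  proof (intro prod.cong refl arg_cong[where f = f])
    fix i r :: nat assume "r \<in> {i * 4..<i * 4 + 4}"
    then show "r div 4 = i" unfolding atLeastLessThan_iff by linarith
  qed
  finally show ?thesis by (simp add: mult.commute prod_power_distrib)
qed

lemma upper_triangular_realification_real_diag:
  "upper_triangular (realification (real_diag n l))"
  unfolding upper_triangular_def carrier_matD[OF realification_carrier[OF real_diag_carrier]]
  by (simp add: index_realification_real_diag)

lemma det_realification_real_diag:
  "det (realification (real_diag n l)) = (\<Prod>i<n. l i) ^ 4"
proof -
  let ?R = "realification (real_diag n l)"
  have R: "?R \<in> carrier_mat (4 * n) (4 * n)" by simp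
  have "det ?R = (\<Prod>r = 0..<4 * n. ?R $$ (r, r))"
    using det_upper_triangular[OF upper_triangular_realification_real_diag R]
    unfolding prod_list_diag_prod carrier_matD[OF R] .
  also have "\<dots> = (\<Prod>r<4 * n. l (r div 4))"
    by (intro prod.cong) (auto simp: index_realification_real_diag)
  also have "\<dots> = (\<Prod>i<n. l i) ^ 4"
    by (rule prod_lessThan_4_mult)
  finally show ?thesis .
qed

lemma char_poly_realification_real_diag:
  "char_poly (realification (real_diag n l)) = (\<Prod>i<n. [:- l i, 1:]) ^ 4"
proof -
  let ?R = "realification (real_diag n l)"
  have R: "?R \<in> carrier_mat (4 * n) (4 * n)" by simp
  have "char_poly ?R = (\<Prod>a\<leftarrow>diag_mat ?R. [:- a, 1:])"
    by (rule char_poly_upper_triangular[OF R upper_triangular_realification_real_diag])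
  also have "\<dots> = (\<Prod>r<4 * n. [:- ?R $$ (r, r), 1:])"
    unfolding diag_mat_def carrier_matD[OF R]
    by (simp add: comp_def lessThan_atLeast0 prod.list_conv_set_nth)
  also have "\<dots> = (\<Prod>r<4 * n. [:- l (r div 4), 1:])"
    by (intro prod.cong) (simp_all add: index_realification_real_diag)
  also have "\<dots> = (\<Prod>i<n. [:- l i, 1:]) ^ 4"
    by (rule prod_lessThan_4_mult)
  finally show ?thesis .
qed

section \<open>Eigenvectors of hyperhermitian matrices\<close>

text \<open>A complex root \<open>z\<close> of the characteristic polynomial has a complex eigenvector \<open>w\<close>. By symmetry the
  number \<open>w\<^sup>* A w = z |w|\<^sup>2\<close> is its own conjugate, so \<open>z\<close> is real, and a real root of a
  real characteristic polynomial has a real eigenvector.\<close>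

lemma symmetric_real_mat_eigenvector:
  fixes A :: "real mat"
  assumes A: "A \<in> carrier_mat n n" and n: "n > 0"
    and sym: "\<And>i j. i < n \<Longrightarrow> j < n \<Longrightarrow> A $$ (i, j) = A $$ (j, i)"
  obtains k v where "v \<in> carrier_vec n" "v \<noteq> 0\<^sub>v n" "A *\<^sub>v v = k \<cdot>\<^sub>v v"
proof -
  define C where "C = map_mat complex_of_real A"
  have C: "C \<in> carrier_mat n n" using A by (simp add: C_def)
  have "degree (char_poly C) = n" using degree_monic_char_poly[OF C] by blast
  then have "\<not> constant (poly (char_poly C))"
    using n by (simp add: constant_degree)
  then obtain z where z: "poly (char_poly C) z = 0"
    using fundamental_theorem_of_algebra by blast
  then have "eigenvalue C z"
    by (simp add: eigenvalue_root_char_poly[OF C])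
  then obtain w where w: "w \<in> carrier_vec n" "w \<noteq> 0\<^sub>v n" "C *\<^sub>v w = z \<cdot>\<^sub>v w"
    using C unfolding eigenvalue_def eigenvector_def by auto
  have row: "(\<Sum>j<n. of_real (A $$ (i, j)) * w $ j) = z * w $ i" if "i < n" for i
  proof -
    have "(C *\<^sub>v w) $ i = (\<Sum>j<n. C $$ (i, j) * w $ j)"
      by (rule index_mult_mat_vec_sum[OF C w(1) that])
    also have "\<dots> = (\<Sum>j<n. of_real (A $$ (i, j)) * w $ j)"
      using A that by (intro sum.cong) (auto simp: C_def)
    finally show ?thesis using w that by (simp del: index_mult_mat_vec)
  qed
  define S where "S = (\<Sum>i<n. \<Sum>j<n. cnj (w $ i) * of_real (A $$ (i, j)) * w $ j)"
  define N where "N = (\<Sum>i<n. (cmod (w $ i))\<^sup>2)"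
  have "S = (\<Sum>i<n. cnj (w $ i) * (\<Sum>j<n. of_real (A $$ (i, j)) * w $ j))"
    by (simp add: S_def sum_distrib_left mult.assoc)
  also have "\<dots> = (\<Sum>i<n. z * (cnj (w $ i) * w $ i))"
    by (intro sum.cong refl) (simp add: row)
  also have "\<dots> = z * of_real N"
    unfolding N_def of_real_sum sum_distrib_left by (simp only: complex_norm_square mult.commute)
  finally have S: "S = z * of_real N" .
  have "cnj S = (\<Sum>i<n. \<Sum>j<n. cnj (w $ j) * of_real (A $$ (i, j)) * w $ i)"
    by (simp add: S_def mult_ac)
  also have "\<dots> = (\<Sum>j<n. \<Sum>i<n. cnj (w $ j) * of_real (A $$ (i, j)) * w $ i)"
    by (rule sum.swap)
  also have "\<dots> = S"
    unfolding S_def by (intro sum.cong refl) (use sym in auto)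
  finally have "cnj S = S" .
  moreover have "N \<noteq> 0"
  proof
    assume "N = 0"
    then have "\<forall>i<n. w $ i = 0" by (auto simp: N_def sum_nonneg_eq_0_iff)
    then have "w = 0\<^sub>v n" using w by (intro eq_vecI) auto
    with w show False by simp
  qed
  ultimately have "cnj z = z" by (simp add: S)
  then obtain k where k: "z = of_real k"
    by (metis Reals_cnj_iff Reals_cases)
  have "char_poly C = map_poly of_real (char_poly A)"
    unfolding C_def by (rule of_real_hom.char_poly_hom[OF A])
  with z k have "poly (char_poly A) k = 0"
    by (metis of_real_hom.poly_map_poly of_real_eq_0_iff)
  then have "eigenvalue A k"
    by (simp add: eigenvalue_root_char_poly[OF A])
  then show ?thesis
    using A that unfolding eigenvalue_def eigenvector_def by auto
qed

lemma realification_symmetric: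
  assumes "A \<in> hyperhermitian n" "r < 4 * n" "s < 4 * n"
  shows "realification A $$ (r, s) = realification A $$ (s, r)"
proof -
  have A: "A \<in> carrier_mat n n" "qadj A = A"
    using assms by (auto simp: hyperhermitian_iff_self_adjoint)
  have rs: "r div 4 < n" "s div 4 < n" using assms by auto
  have "A $$ (r div 4, s div 4) = qcnj (A $$ (s div 4, r div 4))"
    using index_qadj[of "r div 4" A "s div 4"] A rs by simp
  then have "qcnj (quat_unit (r mod 4)) * A $$ (r div 4, s div 4) * quat_unit (s mod 4)
      = qcnj (qcnj (quat_unit (s mod 4)) * A $$ (s div 4, r div 4) * quat_unit (r mod 4))"
    by (simp add: mult.assoc)
  then show ?thesis
    by (simp only: index_realification[OF A(1)] assms quat_sel_simps)
qed

text \<open>The inverse of taking coordinates with respect to the real basis that underlies the realification.\<close>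

definition quat_vec_of_real :: "nat \<Rightarrow> real vec \<Rightarrow> quat vec" where
  "quat_vec_of_real n x = vec n (\<lambda>i. Quat (x $ (4 * i)) (x $ (4 * i + 1)) (x $ (4 * i + 2)) (x $ (4 * i + 3)))"

lemma quat_components:
  "qre (qcnj (quat_unit 0) * y) = qre y" "qre (qcnj (quat_unit 1) * y) = qi y"
  "qre (qcnj (quat_unit 2) * y) = qj y" "qre (qcnj (quat_unit 3) * y) = qk y"
  by (simp_all add: quat_sel_times)

lemma quat_vec_of_real_component:
  assumes "i < n" "p < 4"
  shows "qre (qcnj (quat_unit p) * quat_vec_of_real n x $ i) = x $ (4 * i + p)"
proof -
  have "p = 0 \<or> p = 1 \<or> p = 2 \<or> p = 3" using assms(2) by linarith
  then show ?thesis
    using assms(1) by (elim disjE) (simp_all add: quat_vec_of_real_def quat_sel_times)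
qed

text \<open>The realification of \<open>A\<close> is the real matrix of the left multiplication by \<open>A\<close>, so it transports
  eigenvectors with a real eigenvalue.\<close>

lemma mult_mat_vec_quat_vec_of_real:
  assumes A: "A \<in> carrier_mat n n" and x: "x \<in> carrier_vec (4 * n)"
  shows "A *\<^sub>v quat_vec_of_real n x = quat_vec_of_real n (realification A *\<^sub>v x)"
proof (rule eq_vecI)
  let ?v = "quat_vec_of_real n x"
  have v: "?v \<in> carrier_vec n" by (simp add: quat_vec_of_real_def)
  fix i assume "i < dim_vec (quat_vec_of_real n (realification A *\<^sub>v x))"
  then have i: "i < n" by (simp add: quat_vec_of_real_def)
  have comp: "qre (qcnj (quat_unit p) * (A *\<^sub>v ?v) $ i) = (realification A *\<^sub>v x) $ (4 * i + p)"
    if "p < 4" for p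
  proof -
    have "qre (qcnj (quat_unit p) * (A *\<^sub>v ?v) $ i) = (\<Sum>j<n. qre (qcnj (quat_unit p) * A $$ (i, j) * ?v $ j))"
      by (simp add: index_mult_mat_vec_sum[OF A v i] sum_distrib_left quat_sel_sum mult.assoc
          del: index_mult_mat_vec)
    also have "\<dots> = (\<Sum>j<n. \<Sum>q<4. realification A $$ (4 * i + p, 4 * j + q) * x $ (4 * j + q))"
      using i that
      by (subst qre_times_eq_sum_units)
         (auto simp: quat_vec_of_real_component index_realification[OF A] intro!: sum.cong)
    also have "\<dots> = (\<Sum>t<4 * n. realification A $$ (4 * i + p, t) * x $ t)"
      by (rule sum_lessThan_4_mult[symmetric])
    also have "\<dots> = (realification A *\<^sub>v x) $ (4 * i + p)"
      using realification_carrier[OF A] x by (rule index_mult_mat_vec_sum[symmetric]) (use i that in simp)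
    finally show ?thesis .
  qed
  have "qre (qcnj (quat_unit p) * (A *\<^sub>v ?v) $ i)
      = qre (qcnj (quat_unit p) * quat_vec_of_real n (realification A *\<^sub>v x) $ i)" if "p < 4" for p
    using comp[OF that] quat_vec_of_real_component[OF i that] by simp
  from this[of 0] this[of 1] this[of 2] this[of 3]
  show "(A *\<^sub>v ?v) $ i = quat_vec_of_real n (realification A *\<^sub>v x) $ i"
    by (simp only: quat_components quat_eq_iff)
qed (use A in \<open>simp add: quat_vec_of_real_def\<close>)

text \<open>The eigenspace of a real eigenvalue is closed under right multiplication by quaternions. This leaves room for normalising the
  eigenvector such that its first coordinate is real, as the Householder reflection in
  \<open>qunitary_with_first_column\<close> requires.\<close>

lemma hyperhermitian_eigenvector:
  assumes A: "A \<in> hyperhermitian n" and n: "n > 0"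
  obtains k v a where "v \<in> carrier_vec n" "(\<Sum>i<n. qnorm_sq (v $ i)) = 1" "v $ 0 = of_real a"
    "\<And>i. i < n \<Longrightarrow> (A *\<^sub>v v) $ i = of_real k * v $ i"
proof -
  have Ac: "A \<in> carrier_mat n n" using A by (simp add: hyperhermitian_def)
  obtain k x where x: "x \<in> carrier_vec (4 * n)" "x \<noteq> 0\<^sub>v (4 * n)" "realification A *\<^sub>v x = k \<cdot>\<^sub>v x"
    using symmetric_real_mat_eigenvector[OF realification_carrier[OF Ac] _ realification_symmetric[OF A]] n
    by (metis mult_pos_pos zero_less_numeral)
  define y where "y = quat_vec_of_real n x"
  have y: "y \<in> carrier_vec n" by (simp add: y_def quat_vec_of_real_def)
  have Ay: "(A *\<^sub>v y) $ i = of_real k * y $ i" if "i < n" for i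
  proof -
    have "(A *\<^sub>v y) $ i = quat_vec_of_real n (k \<cdot>\<^sub>v x) $ i"
      unfolding y_def mult_mat_vec_quat_vec_of_real[OF Ac x(1)] x(3) ..
    also have "\<dots> = of_real k * y $ i"
      using that x(1) by (simp add: y_def quat_vec_of_real_def quat_eq_iff quat_sel_times)
    finally show ?thesis .
  qed
  have "\<exists>i<n. y $ i \<noteq> 0"
  proof (rule ccontr)
    assume "\<not> ?thesis"
    then have y0: "y $ i = 0" if "i < n" for i using that by blast
    have "x $ r = 0" if "r < 4 * n" for r
    proof -
      have "x $ (4 * (r div 4) + r mod 4) = qre (qcnj (quat_unit (r mod 4)) * y $ (r div 4))"
        unfolding y_def using that by (intro quat_vec_of_real_component[symmetric]) auto
      then show ?thesis using y0[of "r div 4"] that by simp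
    qed
    then have "x = 0\<^sub>v (4 * n)" using x(1) by (intro eq_vecI) auto
    with x show False by simp
  qed
  then obtain m where m: "m < n" "y $ m \<noteq> 0" by blast
  define N where "N = (\<Sum>i<n. qnorm_sq (y $ i))"
  have "qnorm_sq (y $ m) \<le> N"
    unfolding N_def using m by (intro member_le_sum) auto
  then have N: "N > 0" using m qnorm_sq_pos_iff[of "y $ m"] by linarith
  \<comment> \<open>right multiplication by \<open>q0\<close> turns the first coordinate into a squared norm\<close>
  define q0 where "q0 = (if y $ 0 = 0 then 1 else qcnj (y $ 0))"
  have q0: "qnorm_sq q0 > 0"
    by (simp add: q0_def qnorm_sq_pos_iff quat_eq_iff)
  define c where "c = 1 / sqrt (N * qnorm_sq q0)"
  define q where "q = q0 * of_real c"
  define v where "v = vec n (\<lambda>i. y $ i * q)"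
  show ?thesis
  proof (rule that)
    show v: "v \<in> carrier_vec n" by (simp add: v_def)
    have "c\<^sup>2 = 1 / (N * qnorm_sq q0)"
      using N q0 by (simp add: c_def power_divide)
    moreover have "(\<Sum>i<n. qnorm_sq (v $ i)) = N * (qnorm_sq q0 * c\<^sup>2)"
      unfolding N_def sum_distrib_right
      by (intro sum.cong refl) (simp add: v_def q_def qnorm_sq_mult)
    ultimately show "(\<Sum>i<n. qnorm_sq (v $ i)) = 1"
      using N q0 by simp
    show "v $ 0 = of_real (if y $ 0 = 0 then 0 else qnorm_sq (y $ 0) * c)"
      using n by (simp add: v_def q_def q0_def qcnj_mult_self' flip: mult.assoc)
    show "(A *\<^sub>v v) $ i = of_real k * v $ i" if "i < n" for i
    proof -
      have "(A *\<^sub>v v) $ i = (A *\<^sub>v y) $ i * q"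
        unfolding index_mult_mat_vec_sum[OF Ac v that] index_mult_mat_vec_sum[OF Ac y that]
        by (simp add: v_def sum_distrib_right mult.assoc)
      then show ?thesis using that Ay[OF that] by (simp add: v_def mult.assoc del: index_mult_mat_vec)
    qed
  qed
qed

section \<open>The spectral theorem\<close>

definition spectral_decomposition :: "nat \<Rightarrow> quat mat \<Rightarrow> quat mat \<Rightarrow> (nat \<Rightarrow> real) \<Rightarrow> bool" where
  "spectral_decomposition n A U l \<longleftrightarrow> qunitary n U \<and> A = U * real_diag n l * qadj U"

text \<open>Realification preserves products and the identity matrix, so it turns the factorisation into a similarity of real matrices.\<close>

lemma similar_realification_spectral:
  assumes "spectral_decomposition n A U l"
  shows "similar_mat (realification A) (realification (real_diag n l))"
proof -
  have U: "U \<in> carrier_mat n n" "qadj U * U = 1\<^sub>m n" "U * qadj U = 1\<^sub>m n"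
    and A: "A = U * real_diag n l * qadj U"
    using assms by (auto simp: spectral_decomposition_def qunitary_def)
  have "realification A = realification U * realification (real_diag n l) * realification (qadj U)"
    unfolding A using U(1) by (simp add: realification_mult[of _ n])
  moreover have "realification U * realification (qadj U) = 1\<^sub>m (4 * n)"
    using realification_mult[of U n "qadj U"] U by (simp add: realification_1)
  moreover have "realification (qadj U) * realification U = 1\<^sub>m (4 * n)"
    using realification_mult[of "qadj U" n U] U by (simp add: realification_1)
  moreover have "A \<in> carrier_mat n n"
    unfolding A using U(1) by (meson mult_carrier_mat qadj_carrier real_diag_carrier)
  then have "{realification A, realification (real_diag n l), realification U, realification (qadj U)}
      \<subseteq> carrier_mat (4 * n) (4 * n)"
    using U(1) by simp
  ultimately show ?thesis
    by (intro similar_matI)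
qed

lemma char_poly_realification_spectral:
  assumes "spectral_decomposition n A U l"
  shows "char_poly (realification A) = (\<Prod>i<n. [:- l i, 1:]) ^ 4"
  using char_poly_similar[OF similar_realification_spectral[OF assms]]
  by (simp add: char_poly_realification_real_diag)

lemma det_realification_spectral:
  assumes "spectral_decomposition n A U l"
  shows "det (realification A) = (\<Prod>i<n. l i) ^ 4"
  using det_similar[OF similar_realification_spectral[OF assms]]
  by (simp add: det_realification_real_diag)

lemma qunitary_one: "qunitary n (1\<^sub>m n)"
proof -
  have "qadj (1\<^sub>m n) = 1\<^sub>m n" by (rule eq_matI) auto
  then show ?thesis by (simp add: qunitary_def)
qed

lemma qunitary_mult:
  assumes "qunitary n U" "qunitary n V"
  shows "qunitary n (U * V)"
proof -
  have U: "U \<in> carrier_mat n n" "qadj U \<in> carrier_mat n n" "qadj U * U = 1\<^sub>m n" "U * qadj U = 1\<^sub>m n"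
    and V: "V \<in> carrier_mat n n" "qadj V \<in> carrier_mat n n" "qadj V * V = 1\<^sub>m n" "V * qadj V = 1\<^sub>m n"
    using assms by (auto simp: qunitary_def)
  note assoc = assoc_mult_mat[of _ n n _ n _ n] mult_carrier_mat[of _ n n _ n]
  have "qadj (U * V) * (U * V) = qadj V * ((qadj U * U) * V)"
    using U(1,2) V(1,2) by (simp only: qadj_mult[OF U(1) V(1)] assoc)
  then have 1: "qadj (U * V) * (U * V) = 1\<^sub>m n" using U V by simp
  have "(U * V) * qadj (U * V) = U * ((V * qadj V) * qadj U)"
    using U(1,2) V(1,2) by (simp only: qadj_mult[OF U(1) V(1)] assoc)
  then have 2: "(U * V) * qadj (U * V) = 1\<^sub>m n" using U V by simp
  from 1 2 U V show ?thesis by (simp add: qunitary_def)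
qed

text \<open>The matrix is the Householder reflection that exchanges the first unit vector and \<open>v\<close>, or the identity if the
  two coincide. Over the quaternions this reflection exists when the inner product of the two vectors, which is \<open>v
  0\<close>, is real.\<close>

lemma qunitary_with_first_column:
  assumes v: "(\<Sum>i<n. qnorm_sq (v i)) = 1" "v 0 = of_real a" and n: "n > 0"
  obtains U where "qunitary n U" "\<And>i. i < n \<Longrightarrow> U $$ (i, 0) = v i"
proof (cases "a = 1")
  case True
  have "(\<Sum>i<n. qnorm_sq (v i)) = qnorm_sq (v 0) + (\<Sum>i\<in>{..<n} - {0}. qnorm_sq (v i))"
    using n by (intro sum.remove) auto
  then have "(\<Sum>i\<in>{..<n} - {0}. qnorm_sq (v i)) = 0"
    using v True by (simp add: qnorm_sq_def)
  then have "v i = 0" if "i < n" "i \<noteq> 0" for i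
    using that by (simp add: sum_nonneg_eq_0_iff qnorm_sq_eq_0_iff)
  then have "1\<^sub>m n $$ (i, 0) = v i" if "i < n" for i
    using that v True n by (cases "i = 0") auto
  with qunitary_one that show ?thesis by blast
next
  case False
  define w where "w i = v i - (if i = 0 then 1 else 0)" for i
  define c where "c = 1 / (1 - a)"
  \<comment> \<open>the reflection in the hyperplane orthogonal to \<open>w\<close>, as \<open>|w|\<^sup>2 = 2 - 2 a\<close> makes \<open>c = 2 / |w|\<^sup>2\<close>\<close>
  define U where "U = mat n n (\<lambda>(i, j). (if i = j then 1 else 0) - c *\<^sub>R (w i * qcnj (w j)))"
  have U: "U \<in> carrier_mat n n" by (simp add: U_def)
  have "(\<Sum>i<n. qnorm_sq (w i)) = (\<Sum>i<n. qnorm_sq (v i) + (if i = 0 then 1 - 2 * a else 0))"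
    using v(2) by (intro sum.cong) (auto simp: w_def qnorm_sq_def power2_eq_square algebra_simps)
  also have "\<dots> = 2 - 2 * a"
    using v(1) n by (simp add: sum.distrib)
  finally have "c * (\<Sum>i<n. qnorm_sq (w i)) = 2"
    using False by (simp add: c_def field_simps)
  then have norm: "c *\<^sub>R (\<Sum>k<n. qcnj (w k) * w k) = 1 + 1"
    by (simp add: qcnj_mult_self' scaleR_conv_of_real flip: of_real_sum of_real_mult)
  have self_adj: "qadj U = U"
    by (rule eq_matI) (auto simp: U_def quat_eq_iff quat_sel_times algebra_simps)
  have "U * U = 1\<^sub>m n"
  proof (rule eq_matI)
    fix i j assume "i < dim_row (1\<^sub>m n :: quat mat)" "j < dim_col (1\<^sub>m n :: quat mat)"
    then have ij: "i < n" "j < n" by auto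
    let ?d = "\<lambda>i j. if i = j then 1 else 0 :: quat"
    have "(U * U) $$ (i, j) = (\<Sum>k<n. (?d i k - c *\<^sub>R (w i * qcnj (w k))) * (?d k j - c *\<^sub>R (w k * qcnj (w j))))"
      unfolding index_mult_mat_sum[OF U U ij] using ij by (intro sum.cong refl) (auto simp: U_def)
    also have "\<dots> = (\<Sum>k<n. (if k = i then ?d i j - c *\<^sub>R (w i * qcnj (w j)) else 0)
        - (if k = j then c *\<^sub>R (w i * qcnj (w j)) else 0)
        + c *\<^sub>R (w i * (c *\<^sub>R (qcnj (w k) * w k)) * qcnj (w j)))"
      by (intro sum.cong refl) (auto simp: algebra_simps)
    also have "\<dots> = ?d i j - c *\<^sub>R (w i * qcnj (w j)) - c *\<^sub>R (w i * qcnj (w j))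
        + c *\<^sub>R (w i * (c *\<^sub>R (\<Sum>k<n. qcnj (w k) * w k)) * qcnj (w j))"
      using ij by (simp add: sum.distrib sum_subtractf sum_distrib_left sum_distrib_right scaleR_sum_right)
    also have "\<dots> = ?d i j"
      unfolding norm distrib_left distrib_right mult_1_right scaleR_add_right by simp
    finally show "(U * U) $$ (i, j) = 1\<^sub>m n $$ (i, j)" using ij by simp
  qed (use U in auto)
  with U self_adj have "qunitary n U" by (simp add: qunitary_def)
  moreover have "U $$ (i, 0) = v i" if "i < n" for i
  proof -
    have w0: "w 0 = of_real (a - 1)" using v by (simp add: w_def)
    have "c *\<^sub>R (w i * qcnj (w 0)) = (c * (a - 1)) *\<^sub>R w i"
      unfolding w0 by (simp add: quat_eq_iff quat_sel_times algebra_simps)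
    also have "c * (a - 1) = -1" using False by (simp add: c_def field_simps)
    finally show ?thesis using that n by (auto simp: U_def w_def)
  qed
  ultimately show ?thesis using that by blast
qed

lemma qadj_four_block_mat:
  assumes "A \<in> carrier_mat n1 m1" "B \<in> carrier_mat n1 m2" "C \<in> carrier_mat n2 m1" "D \<in> carrier_mat n2 m2"
  shows "qadj (four_block_mat A B C D) = four_block_mat (qadj A) (qadj C) (qadj B) (qadj D)"
  using assms by (intro eq_matI) auto

lemma qadj_zero [simp]: "qadj (0\<^sub>m n m) = 0\<^sub>m m n"
  by (rule eq_matI) auto

lemma block_diag_mult:
  assumes "A \<in> carrier_mat n n" "B \<in> carrier_mat n n" "C \<in> carrier_mat m m" "D \<in> carrier_mat m m"
  shows "four_block_mat A (0\<^sub>m n m) (0\<^sub>m m n) C * four_block_mat B (0\<^sub>m n m) (0\<^sub>m m n) D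
    = four_block_mat (A * B) (0\<^sub>m n m) (0\<^sub>m m n) (C * D :: 'a :: semiring_0 mat)"
  using assms by (subst mult_four_block_mat[of _ n n _ m _ m _ _ n _ m]) auto

lemma real_diag_Suc:
  "real_diag (Suc n) (case_nat k l) =
    four_block_mat (real_diag 1 (\<lambda>_. k)) (0\<^sub>m 1 n) (0\<^sub>m n 1) (real_diag n l)"
  by (rule eq_matI) (auto simp: real_diag_def split: nat.splits)

lemma spectral_decomposition_block:
  assumes "spectral_decomposition n A V l"
  shows "spectral_decomposition (Suc n)
    (four_block_mat (real_diag 1 (\<lambda>_. k)) (0\<^sub>m 1 n) (0\<^sub>m n 1) A)
    (four_block_mat (1\<^sub>m 1) (0\<^sub>m 1 n) (0\<^sub>m n 1) V) (case_nat k l)"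
proof -
  have V: "V \<in> carrier_mat n n" "qadj V \<in> carrier_mat n n" "qadj V * V = 1\<^sub>m n" "V * qadj V = 1\<^sub>m n"
    and A: "A = V * real_diag n l * qadj V"
    using assms by (auto simp: spectral_decomposition_def qunitary_def)
  define W where "W = four_block_mat (1\<^sub>m 1) (0\<^sub>m 1 n) (0\<^sub>m n 1) V"
  have one: "qadj (1\<^sub>m 1) = 1\<^sub>m 1" by (rule eq_matI) auto
  have W': "qadj W = four_block_mat (1\<^sub>m 1) (0\<^sub>m 1 n) (0\<^sub>m n 1) (qadj V)"
    unfolding W_def using V by (subst qadj_four_block_mat[of _ 1 1 _ n _ n]) (auto simp: one)
  have "W \<in> carrier_mat (1 + n) (1 + n)"
    unfolding W_def using V by (intro four_block_carrier_mat) auto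
  moreover have "qadj W * W = 1\<^sub>m (1 + n)"
    unfolding W' unfolding W_def
    using V by (simp only: block_diag_mult[of _ 1 _ _ n] one_carrier_mat
      left_mult_one_mat[OF one_carrier_mat] four_block_one_mat)
  moreover have "W * qadj W = 1\<^sub>m (1 + n)"
    unfolding W' unfolding W_def
    using V by (simp only: block_diag_mult[of _ 1 _ _ n] one_carrier_mat
      left_mult_one_mat[OF one_carrier_mat] four_block_one_mat)
  ultimately have "qunitary (Suc n) W"
    by (simp add: qunitary_def)
  moreover have "V * real_diag n l \<in> carrier_mat n n"
    using V(1) by (rule mult_carrier_mat) simp
  then have "W * real_diag (Suc n) (case_nat k l) * qadj W =
      four_block_mat (real_diag 1 (\<lambda>_. k)) (0\<^sub>m 1 n) (0\<^sub>m n 1) A"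
    unfolding W' unfolding W_def real_diag_Suc A
    using V(1,2) by (simp only: block_diag_mult[of _ 1 _ _ n] one_carrier_mat real_diag_carrier
      left_mult_one_mat[OF real_diag_carrier] right_mult_one_mat[OF real_diag_carrier])
  ultimately show ?thesis
    by (simp add: spectral_decomposition_def W_def)
qed

lemma spectral_decomposition_conjugate:
  assumes U: "qunitary n U" and A: "A \<in> carrier_mat n n"
    and B: "spectral_decomposition n (qadj U * A * U) W l"
  shows "spectral_decomposition n A (U * W) l"
proof -
  have U': "U \<in> carrier_mat n n" "qadj U \<in> carrier_mat n n" "qadj U * U = 1\<^sub>m n" "U * qadj U = 1\<^sub>m n"
    using U by (auto simp: qunitary_def)
  have W: "W \<in> carrier_mat n n" "qadj W \<in> carrier_mat n n" "qunitary n W"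
    and eq: "qadj U * A * U = W * real_diag n l * qadj W"
    using B by (auto simp: spectral_decomposition_def qunitary_def)
  note assoc = assoc_mult_mat[of _ n n _ n _ n] mult_carrier_mat[of _ n n _ n]
  have "A = (U * qadj U) * A * (U * qadj U)" using A by (simp add: U'(4))
  also have "\<dots> = U * (qadj U * A * U) * qadj U"
    using A U'(1,2) by (simp only: assoc)
  also have "\<dots> = U * (W * real_diag n l * qadj W) * qadj U"
    by (simp only: eq)
  also have "\<dots> = (U * W) * real_diag n l * (qadj W * qadj U)"
    using W(1,2) U'(1,2) by (simp only: assoc real_diag_carrier)
  also have "qadj W * qadj U = qadj (U * W)"
    using W U' by (simp add: qadj_mult)
  finally show ?thesis
    using qunitary_mult[OF U W(3)] by (simp add: spectral_decomposition_def)
qed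

text \<open>Conjugating \<open>A\<close> by a unitary matrix whose first column is an eigenvector yields a matrix with first column
  \<open>(k, 0, \<dots>, 0)\<close>. It is again self-adjoint, so the first row has the same form, and the induction hypothesis
  applies to the remaining block.\<close>

theorem quaternionic_spectral_theorem:
  assumes "A \<in> hyperhermitian n"
  shows "\<exists>U l. spectral_decomposition n A U l"
  using assms
proof (induction n arbitrary: A)
  case 0
  then have "A \<in> carrier_mat 0 0" by (simp add: hyperhermitian_def)
  then have "spectral_decomposition 0 A (1\<^sub>m 0) (\<lambda>_. 0)"
    using qunitary_one[of 0] by (auto simp: spectral_decomposition_def intro!: eq_matI)
  then show ?case by blast
next
  case (Suc n)
  have A: "A \<in> carrier_mat (Suc n) (Suc n)" "qadj A = A"
    using Suc.prems by (auto simp: hyperhermitian_iff_self_adjoint)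
  obtain k v a where v: "v \<in> carrier_vec (Suc n)" "(\<Sum>i<Suc n. qnorm_sq (v $ i)) = 1" "v $ 0 = of_real a"
    and Av: "\<And>i. i < Suc n \<Longrightarrow> (A *\<^sub>v v) $ i = of_real k * v $ i"
    by (rule hyperhermitian_eigenvector[OF Suc.prems zero_less_Suc]) blast
  obtain U where U: "qunitary (Suc n) U" "\<And>i. i < Suc n \<Longrightarrow> U $$ (i, 0) = v $ i"
    by (rule qunitary_with_first_column[OF v(2,3) zero_less_Suc]) blast
  have Uc: "U \<in> carrier_mat (Suc n) (Suc n)" "qadj U \<in> carrier_mat (Suc n) (Suc n)" "qadj U * U = 1\<^sub>m (Suc n)"
    using U by (auto simp: qunitary_def)
  define B where "B = qadj U * A * U"
  have B: "B \<in> carrier_mat (Suc n) (Suc n)" unfolding B_def using A(1) Uc(1,2) by (meson mult_carrier_mat)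
  have B_eq: "B = qadj U * (A * U)"
    unfolding B_def using Uc(2) A(1) Uc(1) by (rule assoc_mult_mat)
  have B_adj: "qadj B = B"
  proof -
    have "qadj B = qadj (A * U) * qadj (qadj U)"
      unfolding B_eq using A Uc by (intro qadj_mult) auto
    also have "\<dots> = qadj U * A * U"
      using A Uc by (simp add: qadj_mult[OF A(1) Uc(1)])
    finally show ?thesis by (simp add: B_def)
  qed
  have B_col: "B $$ (i, 0) = (if i = 0 then of_real k else 0)" if "i < Suc n" for i
  proof -
    have AU: "(A * U) $$ (t, 0) = of_real k * U $$ (t, 0)" if "t < Suc n" for t
    proof -
      have "(A * U) $$ (t, 0) = (A *\<^sub>v v) $ t"
        using U(2) that by (simp add: index_mult_mat_sum[OF A(1) Uc(1)] index_mult_mat_vec_sum[OF A(1) v(1)]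
          del: index_mult_mat index_mult_mat_vec sum.lessThan_Suc)
      then show ?thesis using Av[OF that] U(2)[OF that] by simp
    qed
    have "B $$ (i, 0) = (\<Sum>t<Suc n. qadj U $$ (i, t) * (A * U) $$ (t, 0))"
      unfolding B_eq using A Uc that by (intro index_mult_mat_sum) auto
    also have "\<dots> = of_real k * (\<Sum>t<Suc n. qadj U $$ (i, t) * U $$ (t, 0))"
      unfolding sum_distrib_left
      by (intro sum.cong refl) (simp add: AU mult_of_real_quat_left_commute del: index_mult_mat)
    also have "(\<Sum>t<Suc n. qadj U $$ (i, t) * U $$ (t, 0)) = (qadj U * U) $$ (i, 0)"
      using Uc that by (intro index_mult_mat_sum[symmetric]) auto
    finally show ?thesis using that by (simp add: Uc(3))
  qed
  have B_row: "B $$ (0, i) = (if i = 0 then of_real k else 0)" if "i < Suc n" for i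
    using index_qadj[of 0 B i] B B_adj B_col[OF that] that by auto
  define A' where "A' = mat n n (\<lambda>(i, j). B $$ (Suc i, Suc j))"
  have "A' \<in> hyperhermitian n"
  proof -
    have "qadj A' = A'"
    proof (rule eq_matI)
      fix i j assume "i < dim_row A'" "j < dim_col A'"
      then have ij: "i < n" "j < n" by (auto simp: A'_def)
      then show "qadj A' $$ (i, j) = A' $$ (i, j)"
        using index_qadj[of "Suc i" B "Suc j"] B B_adj by (simp add: A'_def)
    qed (auto simp: A'_def)
    then show ?thesis by (simp add: hyperhermitian_iff_self_adjoint A'_def)
  qed
  then obtain V l where V: "spectral_decomposition n A' V l"
    using Suc.IH by blast
  have "B = four_block_mat (real_diag 1 (\<lambda>_. k)) (0\<^sub>m 1 n) (0\<^sub>m n 1) A'"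
    using B B_col B_row by (intro eq_matI) (auto simp: A'_def real_diag_def)
  then have "spectral_decomposition (Suc n) (qadj U * A * U)
      (four_block_mat (1\<^sub>m 1) (0\<^sub>m 1 n) (0\<^sub>m n 1) V) (case_nat k l)"
    using spectral_decomposition_block[OF V, of k] by (simp add: B_def)
  from spectral_decomposition_conjugate[OF U(1) A(1) this] show ?case by blast
qed

section \<open>Existence and uniqueness of the Moore polynomial\<close>

text \<open>Only the values on hyperhermitian matrices are prescribed, because eigenvalues are chosen for these matrices alone.\<close>

definition herm_polynomial :: "nat \<Rightarrow> (quat mat \<Rightarrow> real) \<Rightarrow> bool" where
  "herm_polynomial n f \<longleftrightarrow> (\<exists>g. entry_polynomial n g \<and> (\<forall>A\<in>hyperhermitian n. f A = g A))"

lemma herm_polynomial_const: "herm_polynomial n (\<lambda>A. c)"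
  unfolding herm_polynomial_def by (blast intro: entry_polynomial.const)

lemma herm_polynomial_add:
  assumes "herm_polynomial n f" "herm_polynomial n g"
  shows "herm_polynomial n (\<lambda>A. f A + g A)"
proof -
  from assms obtain f' g' where "entry_polynomial n f'" "entry_polynomial n g'"
    "\<forall>A\<in>hyperhermitian n. f A = f' A" "\<forall>A\<in>hyperhermitian n. g A = g' A"
    unfolding herm_polynomial_def by blast
  then show ?thesis
    unfolding herm_polynomial_def by (intro exI[of _ "\<lambda>A. f' A + g' A"]) (simp add: entry_polynomial.add)
qed

lemma herm_polynomial_mult:
  assumes "herm_polynomial n f" "herm_polynomial n g"
  shows "herm_polynomial n (\<lambda>A. f A * g A)"
proof -
  from assms obtain f' g' where "entry_polynomial n f'" "entry_polynomial n g'"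
    "\<forall>A\<in>hyperhermitian n. f A = f' A" "\<forall>A\<in>hyperhermitian n. g A = g' A"
    unfolding herm_polynomial_def by blast
  then show ?thesis
    unfolding herm_polynomial_def by (intro exI[of _ "\<lambda>A. f' A * g' A"]) (simp add: entry_polynomial.mult)
qed

lemma herm_polynomial_sum:
  "(\<And>x. x \<in> S \<Longrightarrow> herm_polynomial n (f x)) \<Longrightarrow> herm_polynomial n (\<lambda>A. \<Sum>x\<in>S. f x A)"
  by (induction S rule: infinite_finite_induct)
     (simp_all add: herm_polynomial_const herm_polynomial_add)

lemma herm_polynomial_cong:
  "(\<And>A. A \<in> hyperhermitian n \<Longrightarrow> f A = g A) \<Longrightarrow> herm_polynomial n g \<Longrightarrow> herm_polynomial n f"
  unfolding herm_polynomial_def by auto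

definition herm_polynomial_coeffs :: "nat \<Rightarrow> (quat mat \<Rightarrow> real poly) \<Rightarrow> bool" where
  "herm_polynomial_coeffs n F \<longleftrightarrow> (\<forall>k. herm_polynomial n (\<lambda>A. coeff (F A) k))"

lemma herm_polynomial_coeffs_const: "herm_polynomial_coeffs n (\<lambda>A. p)"
  by (simp add: herm_polynomial_coeffs_def herm_polynomial_const)

lemma herm_polynomial_coeffs_add:
  "herm_polynomial_coeffs n F \<Longrightarrow> herm_polynomial_coeffs n G \<Longrightarrow> herm_polynomial_coeffs n (\<lambda>A. F A + G A)"
  by (simp add: herm_polynomial_coeffs_def herm_polynomial_add)

lemma herm_polynomial_coeffs_mult:
  "herm_polynomial_coeffs n F \<Longrightarrow> herm_polynomial_coeffs n G \<Longrightarrow> herm_polynomial_coeffs n (\<lambda>A. F A * G A)"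
  by (simp add: herm_polynomial_coeffs_def coeff_mult herm_polynomial_sum herm_polynomial_mult)

lemma herm_polynomial_coeffs_sum:
  "(\<And>x. x \<in> S \<Longrightarrow> herm_polynomial_coeffs n (F x)) \<Longrightarrow> herm_polynomial_coeffs n (\<lambda>A. \<Sum>x\<in>S. F x A)"
  by (induction S rule: infinite_finite_induct)
     (simp_all add: herm_polynomial_coeffs_const herm_polynomial_coeffs_add)

lemma herm_polynomial_coeffs_prod:
  "(\<And>x. x \<in> S \<Longrightarrow> herm_polynomial_coeffs n (F x)) \<Longrightarrow> herm_polynomial_coeffs n (\<lambda>A. \<Prod>x\<in>S. F x A)"
  by (induction S rule: infinite_finite_induct)
     (simp_all add: herm_polynomial_coeffs_const herm_polynomial_coeffs_mult)

lemma herm_polynomial_coeffs_cong: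
  "(\<And>A. A \<in> hyperhermitian n \<Longrightarrow> F A = G A) \<Longrightarrow> herm_polynomial_coeffs n G \<Longrightarrow> herm_polynomial_coeffs n F"
  unfolding herm_polynomial_coeffs_def by (auto intro: herm_polynomial_cong[of n _ "\<lambda>A. coeff (G A) _"])

text \<open>Comparing coefficients in \<open>F = G\<^sup>2\<close> gives \<open>F\<^sub>k = 2 G\<^sub>k + \<Sum>0<i<k. G\<^sub>i
  G\<^sub>k\<^sub>-\<^sub>i\<close>, because the constant coefficient of \<open>G\<close> is 1. This determines
  \<open>G\<^sub>k\<close> from \<open>F\<^sub>k\<close> and earlier coefficients of \<open>G\<close> without any division by a
  quantity that depends on the matrix.\<close>

lemma herm_polynomial_coeffs_sqrt:
  assumes F: "herm_polynomial_coeffs n F"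
    and sq: "\<And>A. A \<in> hyperhermitian n \<Longrightarrow> F A = G A * G A"
    and G0: "\<And>A. A \<in> hyperhermitian n \<Longrightarrow> coeff (G A) 0 = 1"
  shows "herm_polynomial_coeffs n G"
  unfolding herm_polynomial_coeffs_def
proof
  fix k
  show "herm_polynomial n (\<lambda>A. coeff (G A) k)"
  proof (induction k rule: less_induct)
    case (less k)
    show ?case
    proof (cases "k = 0")
      case True
      with G0 show ?thesis by (intro herm_polynomial_cong[OF _ herm_polynomial_const[of n 1]]) auto
    next
      case False
      have "coeff (G A) k = 1/2 * (coeff (F A) k + (-1) * (\<Sum>i\<in>{1..<k}. coeff (G A) i * coeff (G A) (k - i)))"
        if A: "A \<in> hyperhermitian n" for A
      proof -
        have "{..k} = insert 0 (insert k {1..<k})" using False by auto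
        then have "coeff (F A) k = 2 * coeff (G A) k + (\<Sum>i\<in>{1..<k}. coeff (G A) i * coeff (G A) (k - i))"
          using False G0[OF A] by (simp add: sq[OF A] coeff_mult)
        then show ?thesis by simp
      qed
      moreover have "herm_polynomial n (\<lambda>A. 1/2 * (coeff (F A) k
          + (-1) * (\<Sum>i\<in>{1..<k}. coeff (G A) i * coeff (G A) (k - i))))"
        using F less unfolding herm_polynomial_coeffs_def
        by (intro herm_polynomial_mult herm_polynomial_const herm_polynomial_add herm_polynomial_sum) auto
      ultimately show ?thesis by (rule herm_polynomial_cong)
    qed
  qed
qed

lemma herm_polynomial_realification:
  assumes "r < 4 * n" "s < 4 * n"
  shows "herm_polynomial n (\<lambda>A. realification A $$ (r, s))"
proof -
  define u where "u = qcnj (quat_unit (r mod 4))"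
  define v where "v = quat_unit (s mod 4)"
  have ij: "r div 4 < n" "s div 4 < n" using assms by auto
  have "realification A $$ (r, s) =
      qre (A $$ (r div 4, s div 4)) * qre (u * v)
      + qi (A $$ (r div 4, s div 4)) * qre (u * Quat 0 1 0 0 * v)
      + qj (A $$ (r div 4, s div 4)) * qre (u * Quat 0 0 1 0 * v)
      + qk (A $$ (r div 4, s div 4)) * qre (u * Quat 0 0 0 1 * v)" if "A \<in> hyperhermitian n" for A
  proof -
    have A: "A \<in> carrier_mat n n" using that by (simp add: hyperhermitian_def)
    show ?thesis
      unfolding index_realification[OF A assms] u_def[symmetric] v_def[symmetric]
      by (simp add: quat_sel_times algebra_simps)
  qed
  moreover have "entry_polynomial n (\<lambda>A.
      qre (A $$ (r div 4, s div 4)) * qre (u * v)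
      + qi (A $$ (r div 4, s div 4)) * qre (u * Quat 0 1 0 0 * v)
      + qj (A $$ (r div 4, s div 4)) * qre (u * Quat 0 0 1 0 * v)
      + qk (A $$ (r div 4, s div 4)) * qre (u * Quat 0 0 0 1 * v))"
    using ij by (intro entry_polynomial.intros)
  ultimately show ?thesis
    unfolding herm_polynomial_def by blast
qed

text \<open>The Leibniz expansion of the determinant builds the characteristic polynomial from the entries by sums and products.\<close>

lemma herm_polynomial_coeffs_char_poly:
  "herm_polynomial_coeffs n (\<lambda>A. char_poly (realification A))"
proof (rule herm_polynomial_coeffs_cong)
  fix A assume "A \<in> hyperhermitian n"
  then have R: "realification A \<in> carrier_mat (4 * n) (4 * n)"
    by (simp add: hyperhermitian_def)
  have "char_poly (realification A) = (\<Sum>p\<in>{p. p permutes {0..<4 * n}}.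
      signof p * (\<Prod>i = 0..<4 * n. char_poly_matrix (realification A) $$ (i, p i)))"
    unfolding char_poly_def by (rule det_def'[OF char_poly_matrix_closed[OF R]])
  also have "\<dots> = (\<Sum>p\<in>{p. p permutes {0..<4 * n}}. signof p *
      (\<Prod>i = 0..<4 * n. (if i = p i then [:0, 1:] else 0)
        + [:- realification A $$ (i, p i):]))"
    using R by (intro sum.cong refl arg_cong2[where f = "(*)"] prod.cong)
      (auto simp: char_poly_matrix_def permutes_in_image[of _ "{0..<4 * n}"] dest: permutes_in_image)
  finally show "char_poly (realification A) = (\<Sum>p\<in>{p. p permutes {0..<4 * n}}. signof p *
      (\<Prod>i = 0..<4 * n. (if i = p i then [:0, 1:] else 0)
        + [:- realification A $$ (i, p i):]))" .
next
  have "herm_polynomial_coeffs n (\<lambda>A. [:- realification A $$ (r, s):])" if rs: "r < 4 * n" "s < 4 * n" for r s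
    unfolding herm_polynomial_coeffs_def
  proof
    fix k :: nat
    have "herm_polynomial n (\<lambda>A. (if k = 0 then -1 else 0) * realification A $$ (r, s))"
      by (intro herm_polynomial_mult herm_polynomial_const herm_polynomial_realification rs)
    then show "herm_polynomial n (\<lambda>A. coeff [:- realification A $$ (r, s):] k)"
      by (rule herm_polynomial_cong[rotated]) (simp add: coeff_pCons split: nat.split)
  qed
  then show "herm_polynomial_coeffs n (\<lambda>A. \<Sum>p\<in>{p. p permutes {0..<4 * n}}. signof p *
      (\<Prod>i = 0..<4 * n. (if i = p i then [:0, 1:] else 0)
        + [:- realification A $$ (i, p i):]))"
    by (intro herm_polynomial_coeffs_sum herm_polynomial_coeffs_mult herm_polynomial_coeffs_prod
        herm_polynomial_coeffs_add herm_polynomial_coeffs_const)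
       (auto dest: permutes_in_image)
qed

lemma reflect_poly_linear_prod:
  fixes l :: "nat \<Rightarrow> real"
  shows "reflect_poly (\<Prod>i<n. [:- l i, 1:]) = (\<Prod>i<n. [:1, - l i:])"
proof -
  have "reflect_poly [:- l i, 1:] = [:1, - l i:]" for i
    by (cases "l i = 0") (simp_all add: reflect_poly_def)
  then show ?thesis by (simp add: reflect_poly_prod)
qed

lemma coeff_linear_prod:
  fixes l :: "nat \<Rightarrow> real"
  shows "coeff (\<Prod>i<n. [:1, - l i:]) n = (-1) ^ n * (\<Prod>i<n. l i)"
proof -
  have "degree (\<Prod>i<n. [:- l i, 1:]) = n"
    by (subst degree_prod_eq_sum_degree) auto
  then have "coeff (\<Prod>i<n. [:1, - l i:]) n = coeff (\<Prod>i<n. [:- l i, 1:]) 0"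
    by (simp add: coeff_reflect_poly flip: reflect_poly_linear_prod)
  also have "\<dots> = (\<Prod>i<n. - l i)"
    by (simp add: poly_prod flip: poly_0_coeff_0)
  also have "\<dots> = (-1) ^ n * (\<Prod>i<n. l i)"
    using prod.distrib[of "\<lambda>_. -1" l "{..<n}"] by simp
  finally show ?thesis .
qed

text \<open>Reversing the coefficients of the characteristic polynomial turns its leading coefficient 1 into a constant coefficient, so
  that two applications of \<open>herm_polynomial_coeffs_sqrt\<close> extract the fourth root \<open>\<Prod>(1 - l\<^sub>i
  X)\<close>.\<close>

lemma herm_polynomial_eigenvalue_prod:
  assumes L: "\<And>A. A \<in> hyperhermitian n \<Longrightarrow> \<exists>U. spectral_decomposition n A U (L A)"
  shows "herm_polynomial n (\<lambda>A. \<Prod>i<n. L A i)"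
proof -
  define R where "R A = (\<Prod>i<n. [:1, - L A i:])" for A
  have cp: "reflect_poly (char_poly (realification A)) = (R A * R A) * (R A * R A)"
    if A: "A \<in> hyperhermitian n" for A
  proof -
    obtain U where "spectral_decomposition n A U (L A)" using L[OF A] by blast
    then show ?thesis
      by (simp add: char_poly_realification_spectral reflect_poly_mult reflect_poly_linear_prod R_def
          power4_eq_xxxx mult.assoc)
  qed
  have R0: "coeff (R A) 0 = 1" for A
    by (simp add: R_def poly_prod flip: poly_0_coeff_0)
  have deg: "degree (char_poly (realification A)) = 4 * n" if "A \<in> hyperhermitian n" for A
    using degree_monic_char_poly[OF realification_carrier[OF hyperhermitian_carrier[OF that]]] by blast
  have "herm_polynomial_coeffs n (\<lambda>A. reflect_poly (char_poly (realification A)))"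
    unfolding herm_polynomial_coeffs_def
  proof
    fix k
    have "herm_polynomial n (\<lambda>A. (if k > 4 * n then 0 else 1) * coeff (char_poly (realification A)) (4 * n - k))"
      using herm_polynomial_coeffs_char_poly[of n] unfolding herm_polynomial_coeffs_def
      by (intro herm_polynomial_mult herm_polynomial_const) blast
    then show "herm_polynomial n (\<lambda>A. coeff (reflect_poly (char_poly (realification A))) k)"
      by (rule herm_polynomial_cong[rotated]) (simp add: coeff_reflect_poly deg)
  qed
  then have "herm_polynomial_coeffs n (\<lambda>A. R A * R A)"
    by (rule herm_polynomial_coeffs_sqrt) (simp_all add: cp coeff_mult R0)
  then have "herm_polynomial_coeffs n R"
    by (rule herm_polynomial_coeffs_sqrt) (simp_all add: R0)
  then have "herm_polynomial n (\<lambda>A. (-1) ^ n * coeff (R A) n)"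
    unfolding herm_polynomial_coeffs_def by (intro herm_polynomial_mult herm_polynomial_const) blast
  then show ?thesis
    by (rule herm_polynomial_cong[rotated]) (simp add: R_def coeff_linear_prod flip: mult.assoc power_mult_distrib)
qed

lemma spectral_decomposition_diag:
  assumes "spectral_decomposition n A U l"
  shows "qadj U * A * U = real_diag n l"
proof -
  have U: "U \<in> carrier_mat n n" "qadj U \<in> carrier_mat n n" "qadj U * U = 1\<^sub>m n"
    and A: "A = U * real_diag n l * qadj U"
    using assms by (auto simp: spectral_decomposition_def qunitary_def)
  have "qadj U * A * U = (qadj U * U) * real_diag n l * (qadj U * U)"
    unfolding A using U(1,2)
    by (simp only: assoc_mult_mat[of _ n n _ n _ n] mult_carrier_mat[of _ n n _ n] real_diag_carrier)
  then show ?thesis unfolding U(3) using real_diag_carrier[of n l] by simp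
qed

lemma one_hyperhermitian: "1\<^sub>m n \<in> hyperhermitian n"
  by (auto simp: hyperhermitian_def)

text \<open>The eigenvalues may be chosen in any order at each matrix, since only their product enters.\<close>

lemma is_moore_polynomial_eigenvalue_prod:
  assumes L: "\<And>A. A \<in> hyperhermitian n \<Longrightarrow> \<exists>U. spectral_decomposition n A U (L A)"
  shows "is_moore_polynomial n (restrict (\<lambda>A. \<Prod>i<n. L A i) (hyperhermitian n))"
  unfolding is_moore_polynomial_def
proof (intro conjI ballI)
  obtain g where "entry_polynomial n g" "\<forall>A\<in>hyperhermitian n. (\<Prod>i<n. L A i) = g A"
    using herm_polynomial_eigenvalue_prod[OF L] unfolding herm_polynomial_def by blast
  then show "restrict (\<lambda>A. \<Prod>i<n. L A i) (hyperhermitian n) \<in> hyperhermitian_polynomials n"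
    unfolding hyperhermitian_polynomials_def by (intro image_eqI[of _ _ g] restrict_ext) auto
next
  fix A assume A: "A \<in> hyperhermitian n"
  then show "det (realification A) = restrict (\<lambda>A. \<Prod>i<n. L A i) (hyperhermitian n) A ^ 4"
    using L[OF A] by (auto simp: det_realification_spectral)
next
  obtain U where U: "spectral_decomposition n (1\<^sub>m n) U (L (1\<^sub>m n))"
    using L[OF one_hyperhermitian] by blast
  have "U \<in> carrier_mat n n" "qadj U \<in> carrier_mat n n" "qadj U * U = 1\<^sub>m n"
    using U by (auto simp: spectral_decomposition_def qunitary_def)
  then have "real_diag n (L (1\<^sub>m n)) = 1\<^sub>m n"
    using spectral_decomposition_diag[OF U] by simp
  then have "L (1\<^sub>m n) i = 1" if "i < n" for i
    using index_real_diag[OF that that, of "L (1\<^sub>m n)"] that by (simp add: quat_eq_iff)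
  then show "restrict (\<lambda>A. \<Prod>i<n. L A i) (hyperhermitian n) (1\<^sub>m n) = 1"
    by (simp add: one_hyperhermitian)
qed

text \<open>Restriction to a line reduces uniqueness of the Moore polynomial to polynomials in one variable.\<close>

lemma entry_polynomial_on_line:
  assumes "entry_polynomial n f"
  shows "\<exists>p. \<forall>t. f (mat n n (\<lambda>ij. B ij + t *\<^sub>R C ij)) = poly p t"
  using assms
proof induction
  case (const c)
  show ?case by (rule exI[of _ "[:c:]"]) simp
next
  case (re i j)
  then show ?case by (intro exI[of _ "[:qre (B (i, j)), qre (C (i, j)):]"]) simp
next
  case (im_i i j)
  then show ?case by (intro exI[of _ "[:qi (B (i, j)), qi (C (i, j)):]"]) simp
next
  case (im_j i j)
  then show ?case by (intro exI[of _ "[:qj (B (i, j)), qj (C (i, j)):]"]) simp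
next
  case (im_k i j)
  then show ?case by (intro exI[of _ "[:qk (B (i, j)), qk (C (i, j)):]"]) simp
next
  case (add f g)
  then show ?case by (metis poly_add)
next
  case (mult f g)
  then show ?case by (metis poly_mult)
qed

text \<open>Two Moore polynomials have equal fourth powers, hence agree up to a sign at each matrix. That the sign is the same everywhere
  is where polynomiality enters: on the line from the identity to \<open>A\<close> the restrictions satisfy \<open>(p - q) (p +
  q) = 0\<close>, and \<open>p + q\<close> has the value 2 at the identity.\<close>

lemma moore_polynomial_unique:
  assumes P: "is_moore_polynomial n P" and Q: "is_moore_polynomial n Q"
  shows "P = Q"
proof -
  obtain f g where f: "entry_polynomial n f" "P = restrict f (hyperhermitian n)"
    and g: "entry_polynomial n g" "Q = restrict g (hyperhermitian n)"
    using assms unfolding is_moore_polynomial_def hyperhermitian_polynomials_def by auto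
  have "f A = g A" if A: "A \<in> hyperhermitian n" for A
  proof -
    let ?I = "\<lambda>ij. 1\<^sub>m n $$ ij"
    let ?C = "\<lambda>ij. A $$ ij - 1\<^sub>m n $$ ij"
    define M where "M t = mat n n (\<lambda>ij. ?I ij + t *\<^sub>R ?C ij)" for t
    obtain p where p: "\<And>t. f (M t) = poly p t"
      using entry_polynomial_on_line[OF f(1), of ?I ?C] unfolding M_def by blast
    obtain q where q: "\<And>t. g (M t) = poly q t"
      using entry_polynomial_on_line[OF g(1), of ?I ?C] unfolding M_def by blast
    have M: "M t \<in> hyperhermitian n" for t
      unfolding hyperhermitian_iff_self_adjoint
    proof (intro conjI eq_matI)
      fix i j assume "i < dim_row (M t)" "j < dim_col (M t)"
      then have ij: "i < n" "j < n" by (auto simp: M_def)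
      have "A $$ (i, j) = qcnj (A $$ (j, i))"
        using A ij unfolding hyperhermitian_def by blast
      then show "qadj (M t) $$ (i, j) = M t $$ (i, j)"
        using ij by (auto simp: M_def quat_eq_iff)
    qed (auto simp: M_def)
    have M0: "M 0 = 1\<^sub>m n" by (rule eq_matI) (auto simp: M_def)
    have M1: "M 1 = A" using hyperhermitian_carrier[OF A] by (intro eq_matI) (auto simp: M_def)
    have "poly ((p - q) * (p + q)) t = 0" for t
    proof -
      have "P (M t) ^ 4 = Q (M t) ^ 4"
        using P Q M unfolding is_moore_polynomial_def by metis
      then have "((poly p t)\<^sup>2)\<^sup>2 = ((poly q t)\<^sup>2)\<^sup>2"
        using M by (simp add: f(2) g(2) p q flip: power_mult)
      then have "(poly p t)\<^sup>2 = (poly q t)\<^sup>2"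
        by (rule power2_eq_imp_eq) simp_all
      then show ?thesis by (simp add: power2_eq_square algebra_simps)
    qed
    then have "(p - q) * (p + q) = 0"
      using poly_all_0_iff_0 by blast
    moreover have "poly p 0 = 1" "poly q 0 = 1"
      using P Q by (simp_all add: is_moore_polynomial_def f(2) g(2) one_hyperhermitian M0 flip: p q)
    then have "poly (p + q) 0 \<noteq> 0" by simp
    then have "p + q \<noteq> 0" by (metis poly_0)
    ultimately have "p = q" by simp
    with p[of 1] q[of 1] show ?thesis by (simp add: M1)
  qed
  then show ?thesis unfolding f(2) g(2) by (rule restrict_ext)
qed

theorem moore_det_eq_prod_eigenvalues:
  assumes "A \<in> hyperhermitian n" and l: "spectral_decomposition n A U l"
  shows "moore_det A = (\<Prod>i<n. l i)"
proof -
  have "\<forall>B. \<exists>l. B \<in> hyperhermitian n \<longrightarrow> (\<exists>U. spectral_decomposition n B U l)"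
    using quaternionic_spectral_theorem by blast
  from choice[OF this] obtain L0
    where L0: "\<And>B. B \<in> hyperhermitian n \<Longrightarrow> \<exists>U. spectral_decomposition n B U (L0 B)"
    by blast
  \<comment> \<open>any choice of eigenvalues yields the Moore polynomial, so the given ones may be chosen at \<open>A\<close>\<close>
  define L where "L = L0(A := l)"
  define P where "P = restrict (\<lambda>B. \<Prod>i<n. L B i) (hyperhermitian n)"
  have "is_moore_polynomial n P"
    unfolding P_def using L0 l by (intro is_moore_polynomial_eigenvalue_prod) (auto simp: L_def)
  then have "(THE P. is_moore_polynomial n P) = P"
    using moore_polynomial_unique by (blast intro: the_equality)
  moreover have "dim_row A = n" using hyperhermitian_carrier[OF assms(1)] by simp
  ultimately show ?thesis
    using assms by (simp add: moore_det_def P_def L_def)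
qed

section \<open>Positive definiteness and leading minors\<close>

definition leading_submatrix :: "'a mat \<Rightarrow> nat \<Rightarrow> 'a mat" where
  "leading_submatrix A m = mat m m (\<lambda>ij. A $$ ij)"

lemma leading_submatrix_carrier [simp]: "leading_submatrix A m \<in> carrier_mat m m"
  by (simp add: leading_submatrix_def)

lemma pick_initial_segment:
  assumes "\<And>a. a \<le> k \<Longrightarrow> a \<in> I"
  shows "pick I k = k"
  using assms
proof (induction k)
  case (Suc k)
  then have "pick I k = k" by simp
  then show ?case using Suc.prems by (auto intro!: Least_equality)
qed (auto intro!: Least_equality)

text \<open>The remaining indices are picked from the infinite complement of the deleted ones, whose elements from \<open>n\<close> on
  exceed the dimension and are never reached.\<close>

lemma delete_indices_eq_leading_submatrix:
  assumes "A \<in> carrier_mat n n" "m \<le> n"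
  shows "delete_indices {m..<n} A = leading_submatrix A m"
proof -
  have "{i. i < n \<and> i \<in> - {m..<n}} = {..<m}" using assms(2) by auto
  then have "card {i. i < n \<and> i \<in> - {m..<n}} = m" by simp
  moreover have "pick (- {m..<n}) k = k" if "k < m" for k
    using that by (intro pick_initial_segment) auto
  ultimately show ?thesis
    using assms unfolding delete_indices_def submatrix_def leading_submatrix_def
    by (intro eq_matI) auto
qed

lemma leading_submatrix_self: "A \<in> carrier_mat n n \<Longrightarrow> leading_submatrix A n = A"
  by (rule eq_matI) (auto simp: leading_submatrix_def)

lemma leading_submatrix_leading_submatrix:
  "k \<le> m \<Longrightarrow> leading_submatrix (leading_submatrix A m) k = leading_submatrix A k"
  by (rule eq_matI) (auto simp: leading_submatrix_def)

lemma hyperhermitian_leading_submatrix: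
  assumes "A \<in> hyperhermitian n" "m \<le> n"
  shows "leading_submatrix A m \<in> hyperhermitian m"
proof -
  have "qcnj (A $$ (j, i)) = A $$ (i, j)" if "i < m" "j < m" for i j
  proof -
    have "i < n" "j < n" using that assms(2) by auto
    then show ?thesis using assms(1) unfolding hyperhermitian_def mem_Collect_eq by metis
  qed
  then have "qadj (leading_submatrix A m) = leading_submatrix A m"
    by (intro eq_matI) (simp_all add: leading_submatrix_def)
  then show ?thesis
    by (simp add: hyperhermitian_iff_self_adjoint)
qed

lemma hform_leading_submatrix:
  assumes "A \<in> carrier_mat n n" "m \<le> n" and zero: "\<And>i. m \<le> i \<Longrightarrow> i < n \<Longrightarrow> x $ i = 0"
  shows "hform (leading_submatrix A m) (vec m (\<lambda>i. x $ i)) (vec m (\<lambda>i. x $ i)) = hform A x x"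
proof -
  have "hform A x x = (\<Sum>i<n. \<Sum>j<n. qcnj (x $ i) * A $$ (i, j) * x $ j)"
    using assms by (simp add: hform_def)
  also have "\<dots> = (\<Sum>i<m. \<Sum>j<n. qcnj (x $ i) * A $$ (i, j) * x $ j)"
    using assms by (intro sum.mono_neutral_right) auto
  also have "\<dots> = (\<Sum>i<m. \<Sum>j<m. qcnj (x $ i) * A $$ (i, j) * x $ j)"
    using assms by (intro sum.cong refl sum.mono_neutral_right) auto
  finally show ?thesis
    by (simp add: hform_def leading_submatrix_def)
qed

lemma positive_definiteD:
  assumes "positive_definite A" "A \<in> carrier_mat n n" "x \<in> carrier_vec n" "x \<noteq> 0\<^sub>v n"
  obtains r :: real where "r > 0" "hform A x x = of_real r"
  using assms unfolding positive_definite_def by auto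

lemma positive_definite_leading_submatrix:
  assumes "positive_definite A" "A \<in> carrier_mat n n" "m \<le> n"
  shows "positive_definite (leading_submatrix A m)"
  unfolding positive_definite_def
proof (intro ballI impI)
  fix x :: "quat vec" assume "x \<in> carrier_vec (dim_row (leading_submatrix A m))" "x \<noteq> 0\<^sub>v (dim_row (leading_submatrix A m))"
  then have x: "x \<in> carrier_vec m" "x \<noteq> 0\<^sub>v m" by (auto simp: leading_submatrix_def)
  define y where "y = vec n (\<lambda>i. if i < m then x $ i else 0)"
  have xy: "vec m (\<lambda>i. y $ i) = x" using x assms(3) by (intro eq_vecI) (auto simp: y_def)
  have "y \<noteq> 0\<^sub>v n"
  proof
    assume "y = 0\<^sub>v n"
    then have "x = 0\<^sub>v m" using assms(3) unfolding xy[symmetric] by (intro eq_vecI) auto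
    with x show False by simp
  qed
  moreover have "y \<in> carrier_vec n" by (simp add: y_def)
  ultimately obtain r where "r > 0" "hform A y y = of_real r"
    using positive_definiteD[OF assms(1,2)] by blast
  moreover have "hform (leading_submatrix A m) x x = hform A y y"
    using hform_leading_submatrix[OF assms(2,3), of y] unfolding xy by (simp add: y_def)
  ultimately show "\<exists>r>0. hform (leading_submatrix A m) x x = of_real r" by auto
qed

text \<open>In the orthonormal basis formed by the columns of \<open>U\<close> the form is diagonal.\<close>

lemma hform_spectral:
  assumes A: "spectral_decomposition n A U l" and x: "x \<in> carrier_vec n"
  shows "hform A x x = of_real (\<Sum>k<n. l k * qnorm_sq ((qadj U *\<^sub>v x) $ k))"
proof -
  have U: "U \<in> carrier_mat n n" "qadj U \<in> carrier_mat n n" and A': "A = U * real_diag n l * qadj U"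
    using A by (auto simp: spectral_decomposition_def qunitary_def)
  have UD: "U * real_diag n l \<in> carrier_mat n n" using U(1) real_diag_carrier by (rule mult_carrier_mat)
  have Ac: "A \<in> carrier_mat n n" unfolding A' using UD U(2) by (rule mult_carrier_mat)
  define y where "y = qadj U *\<^sub>v x"
  have y: "y \<in> carrier_vec n" unfolding y_def using U(2) x by (rule mult_mat_vec_carrier)
  have Dy: "real_diag n l *\<^sub>v y \<in> carrier_vec n" using real_diag_carrier y by (rule mult_mat_vec_carrier)
  have "A *\<^sub>v x = (U * real_diag n l) *\<^sub>v y"
    unfolding A' y_def using UD U(2) x by (rule assoc_mult_mat_vec)
  also have "\<dots> = U *\<^sub>v (real_diag n l *\<^sub>v y)"
    using U(1) real_diag_carrier y by (rule assoc_mult_mat_vec)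
  finally have "hform A x x = qinner x (U *\<^sub>v (real_diag n l *\<^sub>v y))"
    by (simp only: hform_eq_qinner[OF Ac x x])
  also have "\<dots> = qinner y (real_diag n l *\<^sub>v y)"
    unfolding qinner_mult_mat_vec[OF U(1) x Dy] by (simp only: y_def)
  also have "\<dots> = (\<Sum>k<n. qcnj (y $ k) * (real_diag n l *\<^sub>v y) $ k)"
    using y by (simp add: qinner_def)
  also have "\<dots> = (\<Sum>k<n. of_real (l k * qnorm_sq (y $ k)))"
  proof (intro sum.cong refl)
    fix k assume "k \<in> {..<n}"
    then have k: "k < n" by simp
    have "(real_diag n l *\<^sub>v y) $ k = (\<Sum>t<n. if t = k then of_real (l k) * y $ k else 0)"
      unfolding index_mult_mat_vec_sum[OF real_diag_carrier y k]
      using k by (intro sum.cong) (auto simp: index_real_diag)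
    then show "qcnj (y $ k) * (real_diag n l *\<^sub>v y) $ k = of_real (l k * qnorm_sq (y $ k))"
      using k by (simp add: mult_of_real_quat_left_commute qcnj_mult_self' del: index_mult_mat_vec)
  qed
  finally show ?thesis by (simp add: y_def)
qed

lemma qunitary_vec_inverse:
  assumes "qunitary n U" "y \<in> carrier_vec n"
  shows "qadj U *\<^sub>v (U *\<^sub>v y) = y" "U *\<^sub>v (qadj U *\<^sub>v y) = y"
proof -
  have U: "U \<in> carrier_mat n n" "qadj U \<in> carrier_mat n n" "qadj U * U = 1\<^sub>m n" "U * qadj U = 1\<^sub>m n"
    using assms by (auto simp: qunitary_def)
  show "qadj U *\<^sub>v (U *\<^sub>v y) = y"
    using assoc_mult_mat_vec[OF U(2,1) assms(2)] assms(2) by (simp add: U(3))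
  show "U *\<^sub>v (qadj U *\<^sub>v y) = y"
    using assoc_mult_mat_vec[OF U(1,2) assms(2)] assms(2) by (simp add: U(4))
qed

lemma mult_mat_vec_zero: "U \<in> carrier_mat n m \<Longrightarrow> U *\<^sub>v 0\<^sub>v m = 0\<^sub>v n"
  for U :: "'a :: semiring_0 mat"
  by (intro eq_vecI) auto

lemma positive_definite_iff_eigenvalues_positive:
  assumes A: "spectral_decomposition n A U l"
  shows "positive_definite A \<longleftrightarrow> (\<forall>k<n. l k > 0)"
proof -
  have U: "qunitary n U" "U \<in> carrier_mat n n" "qadj U \<in> carrier_mat n n" and A': "A = U * real_diag n l * qadj U"
    using A by (auto simp: spectral_decomposition_def qunitary_def)
  have Ac: "A \<in> carrier_mat n n"
    unfolding A' using U(2,3) real_diag_carrier by (meson mult_carrier_mat)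
  show ?thesis
  proof
    assume pd: "positive_definite A"
    show "\<forall>k<n. l k > 0"
    proof (intro allI impI)
      fix k assume k: "k < n"
      define e where "e = vec n (\<lambda>i. if i = k then 1 else 0 :: quat)"
      define x where "x = U *\<^sub>v e"
      have e: "e \<in> carrier_vec n" by (simp add: e_def)
      have x: "x \<in> carrier_vec n" unfolding x_def using U(2) e by (rule mult_mat_vec_carrier)
      have Ux: "qadj U *\<^sub>v x = e" unfolding x_def by (rule qunitary_vec_inverse[OF U(1) e])
      have "e $ k = 1" using k by (simp add: e_def)
      then have "x \<noteq> 0\<^sub>v n" using mult_mat_vec_zero[OF U(3)] Ux k by auto
      then obtain r where r: "r > 0" "hform A x x = of_real r"
        using positive_definiteD[OF pd Ac x] by blast
      have "(\<Sum>i<n. l i * qnorm_sq (e $ i)) = (\<Sum>i<n. if i = k then l k else 0)"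
        by (intro sum.cong) (auto simp: e_def qnorm_sq_def)
      then show "l k > 0"
        using r k hform_spectral[OF A x] unfolding Ux by (simp only: of_real_eq_iff) simp
    qed
  next
    assume l: "\<forall>k<n. l k > 0"
    show "positive_definite A"
      unfolding positive_definite_def
    proof (intro ballI impI)
      fix x :: "quat vec" assume "x \<in> carrier_vec (dim_row A)" "x \<noteq> 0\<^sub>v (dim_row A)"
      then have x: "x \<in> carrier_vec n" "x \<noteq> 0\<^sub>v n" using Ac by auto
      define y where "y = qadj U *\<^sub>v x"
      have y: "y \<in> carrier_vec n" unfolding y_def using U(3) x(1) by (rule mult_mat_vec_carrier)
      have "y \<noteq> 0\<^sub>v n"
        using x mult_mat_vec_zero[OF U(2)] qunitary_vec_inverse(2)[OF U(1) x(1)] by (auto simp: y_def)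
      then obtain k where k: "k < n" "y $ k \<noteq> 0"
        using y by (metis eq_vecI carrier_vecD index_zero_vec)
      have "(\<Sum>i<n. l i * qnorm_sq (y $ i)) > 0"
        using k l qnorm_sq_pos_iff by (intro sum_pos2[of _ k]) (auto simp: less_imp_le)
      then show "\<exists>r>0. hform A x x = of_real r"
        using hform_spectral[OF A x(1)] by (auto simp: y_def)
    qed
  qed
qed

lemma moore_det_pos_if_positive_definite:
  assumes "A \<in> hyperhermitian n" "positive_definite A"
  shows "moore_det A > 0"
proof -
  obtain U l where U: "spectral_decomposition n A U l"
    using quaternionic_spectral_theorem[OF assms(1)] by blast
  then show ?thesis
    using assms positive_definite_iff_eigenvalues_positive[OF U]
    by (auto simp: moore_det_eq_prod_eigenvalues[OF assms(1) U] intro!: prod_pos)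
qed

text \<open>The sign of the determinant rules out the eigenvalue 0 and a single negative eigenvalue. The leading submatrix rules out two
  negative eigenvalues: their eigenvectors span a two-dimensional space, which meets the hyperplane of vectors with last
  coordinate 0 outside the origin, and at such a vector the form would be both negative and positive.\<close>

lemma positive_definite_step:
  assumes A: "A \<in> hyperhermitian (Suc m)" and minor: "positive_definite (leading_submatrix A m)"
    and det: "moore_det A > 0"
  shows "positive_definite A"
proof -
  obtain U l where dec: "spectral_decomposition (Suc m) A U l"
    using quaternionic_spectral_theorem[OF A] by blast
  have Ac: "A \<in> carrier_mat (Suc m) (Suc m)" using A by (rule hyperhermitian_carrier)
  have U: "qunitary (Suc m) U" "U \<in> carrier_mat (Suc m) (Suc m)" "qadj U \<in> carrier_mat (Suc m) (Suc m)"
    using dec by (auto simp: spectral_decomposition_def qunitary_def)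
  have prod: "(\<Prod>i<Suc m. l i) > 0"
    using det unfolding moore_det_eq_prod_eigenvalues[OF A dec] .
  have "l k > 0" if k: "k < Suc m" for k
  proof (rule ccontr)
    assume "\<not> l k > 0"
    have split: "(\<Prod>i<Suc m. l i) = l k * (\<Prod>i\<in>{..<Suc m} - {k}. l i)"
      using k by (intro prod.remove) auto
    have "\<exists>j\<in>{..<Suc m} - {k}. l j < 0"
    proof (rule ccontr)
      assume "\<not> ?thesis"
      then have "(\<Prod>i\<in>{..<Suc m} - {k}. l i) \<ge> 0" by (intro prod_nonneg) (auto simp: not_less)
      with \<open>\<not> l k > 0\<close> have "(\<Prod>i<Suc m. l i) \<le> 0"
        unfolding split by (intro mult_nonpos_nonneg) auto
      with prod show False by simp
    qed
    then obtain j where j: "j < Suc m" "j \<noteq> k" "l j < 0" by auto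
    have lk: "l k < 0" using prod \<open>\<not> l k > 0\<close> unfolding split by (cases "l k = 0") auto
    \<comment> \<open>coefficients of a combination of the columns \<open>k\<close> and \<open>j\<close> of \<open>U\<close> with last coordinate 0\<close>
    obtain a b where ab: "a \<noteq> 0 \<or> b \<noteq> 0" "U $$ (m, k) * a + U $$ (m, j) * b = 0"
    proof (cases "U $$ (m, k) = 0")
      case True
      then show ?thesis by (intro that[of 1 0]) auto
    next
      case False
      then show ?thesis
        by (intro that[of "- (inverse (U $$ (m, k)) * U $$ (m, j))" 1]) (auto simp flip: mult.assoc)
    qed
    define y where "y = vec (Suc m) (\<lambda>i. if i = k then a else if i = j then b else 0)"
    define x where "x = U *\<^sub>v y"
    have y: "y \<in> carrier_vec (Suc m)" by (simp add: y_def)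
    have x: "x \<in> carrier_vec (Suc m)" unfolding x_def using U(2) y by (rule mult_mat_vec_carrier)
    have Ux: "qadj U *\<^sub>v x = y" unfolding x_def by (rule qunitary_vec_inverse[OF U(1) y])
    have two: "(\<Sum>i<Suc m. g i) = g k + g j" if "\<And>i. i \<noteq> k \<Longrightarrow> i \<noteq> j \<Longrightarrow> g i = 0"
      for g :: "nat \<Rightarrow> 'z :: comm_monoid_add"
    proof -
      have "(\<Sum>i<Suc m. g i) = (\<Sum>i\<in>{k, j}. g i)"
        using k j that by (intro sum.mono_neutral_right) auto
      then show ?thesis using j by simp
    qed
    have "x $ m = (\<Sum>i<Suc m. U $$ (m, i) * y $ i)"
      unfolding x_def by (rule index_mult_mat_vec_sum[OF U(2) y]) simp
    also have "\<dots> = (\<Sum>i<Suc m. U $$ (m, i) * (if i = k then a else if i = j then b else 0))"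
      by (intro sum.cong refl) (simp add: y_def)
    also have "\<dots> = 0"
      using j ab(2) by (subst two) auto
    finally have xm: "x $ m = 0" .
    have "(\<Sum>i<Suc m. l i * qnorm_sq (y $ i))
        = (\<Sum>i<Suc m. l i * qnorm_sq (if i = k then a else if i = j then b else 0))"
      by (intro sum.cong refl) (simp add: y_def)
    also have "\<dots> = l k * qnorm_sq a + l j * qnorm_sq b"
      using j by (subst two) (auto simp: qnorm_sq_eq_0_iff)
    also have "\<dots> < 0"
    proof -
      have "l k * qnorm_sq a \<le> 0" "l j * qnorm_sq b \<le> 0"
        using lk j by (simp_all add: mult_nonpos_nonneg)
      moreover have "l k * qnorm_sq a < 0 \<or> l j * qnorm_sq b < 0"
        using ab(1) lk j by (auto simp: qnorm_sq_pos_iff mult_less_0_iff)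
      ultimately show ?thesis by linarith
    qed
    finally have neg: "(\<Sum>i<Suc m. l i * qnorm_sq (y $ i)) < 0" .
    define z where "z = vec m (\<lambda>i. x $ i)"
    have "z \<noteq> 0\<^sub>v m"
    proof
      assume "z = 0\<^sub>v m"
      then have "x $ i = 0" if "i < m" for i
        using that by (metis z_def index_vec index_zero_vec(1))
      with xm have "x = 0\<^sub>v (Suc m)" using x by (intro eq_vecI) (auto simp: less_Suc_eq)
      then have "y = 0\<^sub>v (Suc m)" using mult_mat_vec_zero[OF U(3)] Ux by simp
      then have "y $ k = 0" "y $ j = 0" using k j by simp_all
      then show False using ab(1) k j by (simp add: y_def)
    qed
    moreover have "z \<in> carrier_vec m" by (simp add: z_def)
    ultimately obtain r where r: "r > 0" "hform (leading_submatrix A m) z z = of_real r"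
      using positive_definiteD[OF minor leading_submatrix_carrier] by blast
    have "hform (leading_submatrix A m) z z = hform A x x"
      unfolding z_def using xm by (intro hform_leading_submatrix[OF Ac]) (auto simp: less_Suc_eq)
    with r have "r = (\<Sum>i<Suc m. l i * qnorm_sq (y $ i))"
      unfolding hform_spectral[OF dec x] Ux by (simp only: of_real_eq_iff)
    with r neg show False by simp
  qed
  then show ?thesis
    using positive_definite_iff_eigenvalues_positive[OF dec] by simp
qed

theorem theorem1p1p13:
  fixes n :: nat and A :: "quat mat"
  assumes "A \<in> hyperhermitian n"
  shows "positive_definite A \<longleftrightarrow> (\<forall>i\<le>n. moore_det (delete_indices {i..<n} A) > 0)"
proof -
  have Ac: "A \<in> carrier_mat n n" using assms by (rule hyperhermitian_carrier)
  show ?thesis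
  proof
    assume "positive_definite A"
    then have "moore_det (leading_submatrix A i) > 0" if "i \<le> n" for i
      using that by (intro moore_det_pos_if_positive_definite[of _ i] hyperhermitian_leading_submatrix[OF assms]
          positive_definite_leading_submatrix[OF _ Ac])
    then show "\<forall>i\<le>n. moore_det (delete_indices {i..<n} A) > 0"
      by (simp add: delete_indices_eq_leading_submatrix[OF Ac])
  next
    assume "\<forall>i\<le>n. moore_det (delete_indices {i..<n} A) > 0"
    then have det: "moore_det (leading_submatrix A i) > 0" if "i \<le> n" for i
      using that by (simp add: delete_indices_eq_leading_submatrix[OF Ac])
    have "positive_definite (leading_submatrix A m)" if "m \<le> n" for m
      using that
    proof (induction m)
      case 0
      then show ?case by (auto simp: positive_definite_def leading_submatrix_def)
    next
      case (Suc m)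
      then have "positive_definite (leading_submatrix (leading_submatrix A (Suc m)) m)"
        by (simp add: leading_submatrix_leading_submatrix)
      then show ?case
        by (rule positive_definite_step[OF hyperhermitian_leading_submatrix[OF assms Suc.prems] _ det[OF Suc.prems]])
    qed
    from this[of n] show "positive_definite A"
      by (simp add: leading_submatrix_self[OF Ac])
  qed
qed

end
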